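(* Let $\mathbf{x}\in L^2(\mathbb{R})$, let $k\in\mathbb{Q}^+$ and let $\theta\in\mathbb{R}$ with $\theta\notin\pi\mathbb{Z}$. Then the new fractional ambiguity function has the frequency marginal property $$\int_{\mathbb{R}}\mathcal{A}^{\theta,k}_{\mathbf{x}}(\tau,u)\,d\tau=\frac{1}{k}\,\mathcal{F}^{\theta}[\mathbf{x}]\left(\tfrac{u}{2}\right)\left(\mathcal{F}^{\theta}[\mathbf{x}]\left(-\tfrac{u}{2}\right)\right)^*.$$
   Context: Superscript $*$ denotes complex conjugation. $\Omega_\theta=\sqrt{(1-i\cot\theta)/2\pi}$, so $|\Omega_\theta|^2=|\csc\theta|/(2\pi)$. The new fractional ambiguity function (NFrAF) of $\mathbf{x}\in L^2(\mathbb{R})$ with parameters $(\theta,k)$ is $$\mathcal{A}^{\theta,k}_{\mathbf{x}}(\tau,u)=|\Omega_\theta|^2\int_{\mathbb{R}}\mathbf{x}\left(t+k\tfrac{\tau}{2}\right)\mathbf{x}^*\left(t-k\tfrac{\tau}{2}\right)e^{it(k\tau\cot\theta-u\csc\theta)}\,dt.$$ The fractional Fourier transform of order $\theta\notin\pi\mathbb{Z}$ is $$\mathcal{F}^\theta[\mathbf{x}](u)=\int_{\mathbb{R}}\mathbf{x}(t)\,\mathcal{K}_\theta(t,u)\,dt,\qquad \mathcal{K}_\theta(t,u)=\Omega_\theta\, e^{\frac{i}{2}(t^2+u^2)\cot\theta-iut\csc\theta}.$$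
   Formalization: For general x in L² the τ-integral may diverge and the transform is defined only a.e.; the identity is proved for a.e. u where the integral exists, and for all x in L² as an L¹(du) limit of Gaussian-damped integrals; for x also in L¹ it holds for every u. *)

theory Defs
  imports "HOL-Analysis.Analysis"
begin

definition square_integrable :: "(real \<Rightarrow> complex) \<Rightarrow> bool" where
  "square_integrable x \<longleftrightarrow>
     x \<in> borel_measurable lborel \<and> integrable lborel (\<lambda>t. (cmod (x t))\<^sup>2)"

definition csc :: "real \<Rightarrow> real" where
  "csc \<theta> = 1 / sin \<theta>"

definition Omega :: "real \<Rightarrow> complex" where
  "Omega \<theta> = csqrt ((1 - \<i> * of_real (cot \<theta>)) / (2 * of_real pi))"

definition nfraf :: "real \<Rightarrow> real \<Rightarrow> (real \<Rightarrow> complex) \<Rightarrow> real \<Rightarrow> real \<Rightarrow> complex" where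
  "nfraf \<theta> k x \<tau> u =
     of_real ((cmod (Omega \<theta>))\<^sup>2) *
     (LBINT t. x (t + k * \<tau> / 2) * cnj (x (t - k * \<tau> / 2)) *
        exp (\<i> * of_real (t * (k * \<tau> * cot \<theta> - u * csc \<theta>))))"

text \<open>For square-integrable \<open>x\<close> the integral over \<open>t\<close> converges absolutely, but \<open>nfraf \<theta> k x \<tau> u\<close>
  need not be integrable in \<open>\<tau>\<close> unless \<open>x\<close> is integrable as well, and Isabelle's integral of a
  non-integrable function is 0.  Outside that case the marginal is therefore read either as a
  Lebesgue integral where it exists, or as the limit in \<open>L\<^sup>1(du)\<close> of the integrals damped by
  \<open>exp (- \<epsilon> * \<tau>\<^sup>2)\<close> as \<open>\<epsilon>\<close> tends to 0 from above.\<close>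

definition frft_kernel :: "real \<Rightarrow> real \<Rightarrow> real \<Rightarrow> complex" where
  "frft_kernel \<theta> t u =
     Omega \<theta> * exp (\<i> / 2 * of_real ((t\<^sup>2 + u\<^sup>2) * cot \<theta>) - \<i> * of_real (u * t * csc \<theta>))"

text \<open>The kernel has constant modulus in \<open>t\<close>, so the integral defining the transform converges
  absolutely precisely when \<open>x\<close> is integrable.  For the other square-integrable \<open>x\<close> the integral is
  read, as usual in the \<open>L\<^sup>2\<close> theory, as the limit in mean square of the truncated integrals; this
  determines the transform up to a null set, and \<open>frft\<close> is a fixed representative.\<close>

definition is_frft_mean_limit :: "real \<Rightarrow> (real \<Rightarrow> complex) \<Rightarrow> (real \<Rightarrow> complex) \<Rightarrow> bool" where
  "is_frft_mean_limit \<theta> x F \<longleftrightarrow>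
     square_integrable F \<and>
     ((\<lambda>R. \<integral>\<^sup>+ u. ennreal ((cmod ((LBINT t:{-R..R}. x t * frft_kernel \<theta> t u) - F u))\<^sup>2) \<partial>lborel)
        \<longlongrightarrow> 0) at_top"

definition frft :: "real \<Rightarrow> (real \<Rightarrow> complex) \<Rightarrow> real \<Rightarrow> complex" where
  "frft \<theta> x =
     (if integrable lborel x then (\<lambda>u. LBINT t. x t * frft_kernel \<theta> t u)
      else (SOME F. is_frft_mean_limit \<theta> x F))"

end

theory Submission
  imports Defs "HOL-Probability.Probability"
begin

text \<open>
  Put \<open>y t = x t * cis (t\<^sup>2 * cot \<theta> / 2)\<close>.  The chirp turns the fractional transforms into ordinary ones:
  \<open>frft \<theta> x u\<close> is \<open>Omega \<theta> * cis (u\<^sup>2 * cot \<theta> / 2)\<close> times the Fourier transform of \<open>y\<close> at \<open>u * csc \<theta>\<close>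
  (\<open>frft_int_eq_ft\<close>), and the NFrAF is \<open>\<bar>Omega \<theta>\<bar>\<^sup>2\<close> times the ordinary ambiguity function of \<open>y\<close>
  (\<open>nfraf_eq_amb\<close>).  For integrable \<open>x\<close> the marginal is then Fubini's theorem after the substitution
  \<open>p = t + k * \<tau> / 2\<close>, \<open>q = t - k * \<tau> / 2\<close> (\<open>amb_marginal\<close>).

  For square-integrable \<open>x\<close> write \<open>\<Phi>\<close> for the Fourier transform of \<open>y\<close> and \<open>c = csc \<theta>\<close>.  Damping by
  \<open>exp (- \<epsilon> * \<tau>\<^sup>2)\<close> multiplies the integrand in \<open>(p, q)\<close> by a Gaussian in \<open>p - q\<close>, that is, by the
  characteristic function of a normal density \<open>\<gamma>\<close> whose variance is proportional to \<open>\<epsilon>\<close>.  So the damped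
  marginal is, up to constants, the average of \<open>\<Phi> (u * c / 2 + \<eta>) * cnj (\<Phi> (- u * c / 2 + \<eta>))\<close> over \<open>\<eta>\<close>
  with weight \<open>\<gamma>\<close> (\<open>amb_damped_marginal_ft\<close>).  The distance in \<open>L\<^sup>1(du)\<close> to the value at \<open>\<eta> = 0\<close> is
  controlled by the modulus of continuity of translations of \<open>\<Phi>\<close> in \<open>L\<^sup>2\<close>, and translating \<open>\<Phi>\<close> by \<open>\<eta>\<close>
  multiplies \<open>y t\<close> by \<open>cis (- (\<eta> * t))\<close>.  The Plancherel inequality \<open>l2sq_ft_le\<close> therefore bounds the
  distance, for every \<open>\<delta> > 0\<close>, by a multiple of \<open>\<delta> * \<parallel>x\<parallel>\<^sup>2\<close> plus a multiple of \<open>1 / \<delta>\<close> times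
  \<open>\<integral> (2 - 2 * exp (- (\<sigma>\<^sup>2 * t\<^sup>2 / 2))) * \<bar>x t\<bar>\<^sup>2 dt\<close>, where \<open>\<sigma>\<^sup>2\<close> is the variance of \<open>\<gamma>\<close>; the integral
  vanishes in the limit by dominated convergence.  The estimate is proved for truncations of \<open>x\<close>, whose
  transforms are absolutely convergent, and passes to \<open>x\<close> by Fatou's lemma (\<open>damped_marginal_L1_bound\<close>).

  The transform of a non-integrable \<open>x\<close> is a mean limit picked by a choice operator, so its existence has to
  be shown: the transforms of the truncations form a Cauchy family in \<open>L\<^sup>2\<close> by the Plancherel inequality,
  and completeness gives the limit (\<open>frft_mean_limit_exists\<close>).  Finally, convergence in \<open>L\<^sup>1(du)\<close> forces the
  almost-everywhere identity wherever the undamped integral exists (\<open>marginal_AE_of_damped\<close>).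
\<close>

section \<open>Gaussian averages of Fourier transforms\<close>

lemma measurable_cis [measurable]: "cis \<in> borel_measurable borel"
  by (intro borel_measurable_continuous_onI continuous_intros)

lemma measurable_cnj [measurable]: "cnj \<in> borel_measurable borel"
  by (intro borel_measurable_continuous_onI continuous_intros)

lemma nn_integral_lborel_affine:
  fixes c t :: real
  assumes [measurable]: "f \<in> borel_measurable borel" and c: "c \<noteq> 0"
  shows "(\<integral>\<^sup>+x. f (t + c * x) \<partial>lborel) = ennreal (1 / \<bar>c\<bar>) * (\<integral>\<^sup>+x. f x \<partial>lborel)"
proof -
  have "ennreal (1 / \<bar>c\<bar>) * (\<integral>\<^sup>+x. f x \<partial>lborel)
      = ennreal (1 / \<bar>c\<bar>) * ennreal \<bar>c\<bar> * (\<integral>\<^sup>+x. f (t + c * x) \<partial>lborel)"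
    using nn_integral_real_affine[OF assms, of t] by (simp add: mult.assoc)
  also have "ennreal (1 / \<bar>c\<bar>) * ennreal \<bar>c\<bar> = 1"
    using c by (simp flip: ennreal_mult)
  finally show ?thesis by simp
qed

lemma integrable_tensor:
  fixes f g :: "real \<Rightarrow> complex"
  assumes f: "integrable lborel f" and g: "integrable lborel g"
  shows "integrable (lborel \<Otimes>\<^sub>M lborel) (\<lambda>(p, q). f p * g q)"
proof -
  have [measurable]: "f \<in> borel_measurable lborel" "g \<in> borel_measurable lborel"
    using f g by auto
  show ?thesis
    by (rule lborel_pair.Fubini_integrable)
       (auto simp: norm_mult intro!: integrable_mult_left integrable_mult_right f g)
qed

lemma integral_tensor:
  fixes f g :: "real \<Rightarrow> complex"
  assumes f: "integrable lborel f" and g: "integrable lborel g"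
  shows "(\<integral>(p, q). f p * g q \<partial>(lborel \<Otimes>\<^sub>M lborel)) = (LBINT p. f p) * (LBINT q. g q)"
  using lborel_pair.integral_fst'[OF integrable_tensor[OF f g]] by (simp add: case_prod_unfold)

lemma integral_normal_density_cis:
  assumes \<sigma>: "\<sigma> > 0"
  shows "(LBINT \<eta>. of_real (normal_density 0 \<sigma> \<eta>) * cis (- (\<eta> * s)))
       = of_real (exp (- (\<sigma>\<^sup>2 * s\<^sup>2 / 2)))"
proof -
  have "(LBINT \<eta>. of_real (normal_density 0 \<sigma> \<eta>) * cis (- (\<eta> * s)))
      = \<bar>\<sigma>\<bar> *\<^sub>R (LBINT z. of_real (normal_density 0 \<sigma> (0 + \<sigma> * z)) * cis (- ((0 + \<sigma> * z) * s)))"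
    using \<sigma> by (subst lborel_integral_real_affine[where c=\<sigma> and t=0]) simp_all
  also have "\<dots> = (LBINT z. \<bar>\<sigma>\<bar> *\<^sub>R (of_real (normal_density 0 \<sigma> (0 + \<sigma> * z)) * cis (- ((0 + \<sigma> * z) * s))))"
    by (rule integral_scaleR_right[symmetric]) 
  also have "\<dots> = (LBINT z. std_normal_density z *\<^sub>R iexp ((- \<sigma> * s) * z))"
    using \<sigma> by (intro Bochner_Integration.integral_cong refl)
       (simp add: normal_density_def cis_conv_exp power_mult_distrib real_sqrt_mult scaleR_conv_of_real
          field_simps)
  also have "\<dots> = char std_normal_distribution (- \<sigma> * s)"
    unfolding char_def by (subst integral_density) auto
  also have "\<dots> = of_real (exp (- (\<sigma>\<^sup>2 * s\<^sup>2 / 2)))"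
    by (simp add: char_std_normal_distribution power_mult_distrib)
  finally show ?thesis .
qed

text \<open>Averaging over a Gaussian frequency \<open>\<eta>\<close> damps a phase \<open>\<phi>\<close> by \<open>exp (- (\<sigma>\<^sup>2 * \<phi>\<^sup>2 / 2))\<close>.\<close>

lemma integral_normal_density_average:
  fixes h :: "'a \<Rightarrow> complex"
  assumes N: "sigma_finite_measure N" and h: "integrable N h"
    and \<phi> [measurable]: "\<phi> \<in> borel_measurable N" and \<sigma>: "\<sigma> > 0"
  shows "(LBINT \<eta>. of_real (normal_density 0 \<sigma> \<eta>) * (\<integral>z. h z * cis (- (\<eta> * \<phi> z)) \<partial>N))
       = (\<integral>z. h z * of_real (exp (- (\<sigma>\<^sup>2 * (\<phi> z)\<^sup>2 / 2))) \<partial>N)"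
proof -
  interpret N: sigma_finite_measure N by fact
  interpret pair_sigma_finite N "lborel :: real measure" ..
  have [measurable]: "h \<in> borel_measurable N" using h by auto
  have int: "integrable (N \<Otimes>\<^sub>M lborel)
      (\<lambda>(z, \<eta>). of_real (normal_density 0 \<sigma> \<eta>) * (h z * cis (- (\<eta> * \<phi> z))))"
  proof (rule Fubini_integrable)
    show "AE z in N. integrable lborel (\<lambda>\<eta>. case (z, \<eta>) of (z, \<eta>) \<Rightarrow>
        of_real (normal_density 0 \<sigma> \<eta>) * (h z * cis (- (\<eta> * \<phi> z))))"
    proof (rule AE_I2)
      fix z
      have "integrable lborel (\<lambda>\<eta>. normal_density 0 \<sigma> \<eta> * cmod (h z))" using \<sigma> by (intro integrable_mult_left) auto
      then show "integrable lborel (\<lambda>\<eta>. case (z, \<eta>) of (z, \<eta>) \<Rightarrow>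
        of_real (normal_density 0 \<sigma> \<eta>) * (h z * cis (- (\<eta> * \<phi> z))))"
        by (rule Bochner_Integration.integrable_bound) (auto simp: norm_mult)
    qed
  qed (auto simp: norm_mult intro!: h)
  have "(LBINT \<eta>. of_real (normal_density 0 \<sigma> \<eta>) * (\<integral>z. h z * cis (- (\<eta> * \<phi> z)) \<partial>N))
      = (LBINT \<eta>. (\<integral>z. of_real (normal_density 0 \<sigma> \<eta>) * (h z * cis (- (\<eta> * \<phi> z))) \<partial>N))"
    by simp
  also have "\<dots> = (\<integral>z. (LBINT \<eta>. of_real (normal_density 0 \<sigma> \<eta>) * (h z * cis (- (\<eta> * \<phi> z)))) \<partial>N)"
    by (rule Fubini_integral[OF int])
  also have "\<dots> = (\<integral>z. h z * (LBINT \<eta>. of_real (normal_density 0 \<sigma> \<eta>) * cis (- (\<eta> * \<phi> z))) \<partial>N)"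
    by (simp add: mult.left_commute)
  finally show ?thesis
    by (simp add: integral_normal_density_cis[OF \<sigma>])
qed

text \<open>The Fourier transform with kernel \<open>exp (- \<i> * \<xi> * t)\<close> and no normalizing factor, as an
  absolutely convergent integral; for a non-integrable \<open>f\<close> it has the default value 0.\<close>

definition ft :: "(real \<Rightarrow> complex) \<Rightarrow> real \<Rightarrow> complex" where
  "ft f \<xi> = (LBINT t. f t * cis (- (\<xi> * t)))"

lemma measurable_ft [measurable]:
  assumes [measurable]: "f \<in> borel_measurable borel"
  shows "ft f \<in> borel_measurable borel"
  unfolding ft_def by measurable

lemma integrable_mult_cis:
  fixes f :: "'a \<Rightarrow> complex"
  assumes "integrable N f" and [measurable]: "\<phi> \<in> borel_measurable N"
  shows "integrable N (\<lambda>t. f t * cis (\<phi> t))"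
  using assms(1) by (rule Bochner_Integration.integrable_bound) (use assms in \<open>auto simp: norm_mult\<close>)

lemma norm_ft_le:
  "cmod (ft f \<xi>) \<le> (LBINT t. cmod (f t))"
  unfolding ft_def by (rule order_trans[OF integral_norm_bound]) (simp add: norm_mult)

lemma ft_modulate: "ft (\<lambda>t. f t * cis (- (a * t))) \<xi> = ft f (a + \<xi>)"
  unfolding ft_def by (intro Bochner_Integration.integral_cong) (auto simp: cis_mult algebra_simps)

lemma ft_diff:
  assumes "integrable lborel f" "integrable lborel g"
  shows "ft (\<lambda>t. f t - g t) \<xi> = ft f \<xi> - ft g \<xi>"
  unfolding ft_def left_diff_distrib
  by (intro Bochner_Integration.integral_diff integrable_mult_cis assms) auto

lemma ft_mult_cnj_ft:
  assumes f: "integrable lborel f" and g: "integrable lborel g"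
  shows "ft f a * cnj (ft g b)
    = (\<integral>(p, q). f p * cnj (g q) * cis (- (a * p - b * q)) \<partial>(lborel \<Otimes>\<^sub>M lborel))"
proof -
  have "ft f a * cnj (ft g b) = (LBINT p. f p * cis (- (a * p))) * (LBINT q. cnj (g q * cis (- (b * q))))"
    unfolding ft_def by (simp only: Bochner_Integration.integral_cnj)
  also have "\<dots> = (\<integral>(p, q). (f p * cis (- (a * p))) * cnj (g q * cis (- (b * q))) \<partial>(lborel \<Otimes>\<^sub>M lborel))"
    by (rule integral_tensor[symmetric])
       (intro integrable_mult_cis integrable_cnj f g; measurable)+
  also have "\<dots> = (\<integral>(p, q). f p * cnj (g q) * cis (- (a * p - b * q)) \<partial>(lborel \<Otimes>\<^sub>M lborel))"
    by (intro Bochner_Integration.integral_cong)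
       (auto simp: cis_cnj cis_mult algebra_simps)
  finally show ?thesis .
qed

text \<open>This identity is used twice: with \<open>a = b = 0\<close> and \<open>f = g\<close> it gives the Plancherel inequality, and
  with \<open>b = - a\<close> its right-hand side is a damped marginal of the ambiguity function.\<close>

lemma integral_normal_density_ft:
  assumes f: "integrable lborel f" and g: "integrable lborel g" and \<sigma>: "\<sigma> > 0"
  shows "(LBINT \<eta>. of_real (normal_density 0 \<sigma> \<eta>) * (ft f (a + \<eta>) * cnj (ft g (b + \<eta>))))
    = (\<integral>(p, q). f p * cnj (g q) * cis (- (a * p - b * q)) * of_real (exp (- (\<sigma>\<^sup>2 * (p - q)\<^sup>2 / 2)))
         \<partial>(lborel \<Otimes>\<^sub>M lborel))"
proof -
  have [measurable]: "f \<in> borel_measurable borel" "g \<in> borel_measurable borel" using f g by auto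
  have sf: "sigma_finite_measure (lborel \<Otimes>\<^sub>M lborel :: (real \<times> real) measure)" ..
  have "integrable (lborel \<Otimes>\<^sub>M lborel) (\<lambda>(p, q). f p * cnj (g q))"
    using f g by (intro integrable_tensor integrable_cnj)
  then have int: "integrable (lborel \<Otimes>\<^sub>M lborel)
      (\<lambda>z. (f (fst z) * cnj (g (snd z))) * cis (- (a * fst z - b * snd z)))"
    unfolding case_prod_unfold by (rule integrable_mult_cis) measurable
  have "ft f (a + \<eta>) * cnj (ft g (b + \<eta>)) = (\<integral>z. f (fst z) * cnj (g (snd z))
       * cis (- (a * fst z - b * snd z)) * cis (- (\<eta> * (fst z - snd z))) \<partial>(lborel \<Otimes>\<^sub>M lborel))" for \<eta>
    unfolding ft_mult_cnj_ft[OF f g] case_prod_unfold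
    by (intro Bochner_Integration.integral_cong) (auto simp: cis_mult mult.assoc algebra_simps)
  then show ?thesis
    using integral_normal_density_average[OF sf int _ \<sigma>, of "\<lambda>z. fst z - snd z"]
    by (simp add: case_prod_unfold)
qed

section \<open>The Plancherel inequality\<close>

text \<open>The square of the \<open>L\<^sup>2\<close> norm, with value \<open>\<infinity>\<close> allowed, so that no integrability has to be carried
  along in estimates.\<close>

definition l2sq :: "(real \<Rightarrow> complex) \<Rightarrow> ennreal" where
  "l2sq f = (\<integral>\<^sup>+ t. ennreal ((cmod (f t))\<^sup>2) \<partial>lborel)"

lemma nn_integral_gaussian:
  assumes \<sigma>: "\<sigma> > 0"
  shows "(\<integral>\<^sup>+ q. ennreal (exp (- (\<sigma>\<^sup>2 * (p - q)\<^sup>2 / 2))) \<partial>lborel) = ennreal (sqrt (2 * pi / \<sigma>\<^sup>2))"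
proof -
  have "exp (- (\<sigma>\<^sup>2 * (p - q)\<^sup>2 / 2)) = sqrt (2 * pi / \<sigma>\<^sup>2) * normal_density p (1 / \<sigma>) q" for q
    using \<sigma> by (simp add: normal_density_def power_divide real_sqrt_divide real_sqrt_mult field_simps
          power2_commute)
  then have "(\<integral>\<^sup>+ q. ennreal (exp (- (\<sigma>\<^sup>2 * (p - q)\<^sup>2 / 2))) \<partial>lborel)
      = ennreal (sqrt (2 * pi / \<sigma>\<^sup>2)) * (\<integral>\<^sup>+ q. ennreal (normal_density p (1 / \<sigma>) q) \<partial>lborel)"
    by (simp add: ennreal_mult' nn_integral_cmult)
  also have "(\<integral>\<^sup>+ q. ennreal (normal_density p (1 / \<sigma>) q) \<partial>lborel) = 1"
    using \<sigma> by (subst nn_integral_eq_integral) auto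
  finally show ?thesis by simp
qed

text \<open>Schur's bound for the Gaussian kernel: \<open>\<bar>f p\<bar> * \<bar>f q\<bar>\<close> is at most the mean of the squares, and the
  kernel has the same integral in either variable.\<close>

lemma nn_integral_gaussian_product_le:
  fixes f :: "real \<Rightarrow> complex"
  assumes [measurable]: "f \<in> borel_measurable borel" and \<sigma>: "\<sigma> > 0"
  shows "(\<integral>\<^sup>+ z. ennreal (cmod (f (fst z)) * cmod (f (snd z)) * exp (- (\<sigma>\<^sup>2 * (fst z - snd z)\<^sup>2 / 2)))
            \<partial>(lborel \<Otimes>\<^sub>M lborel)) \<le> ennreal (sqrt (2 * pi / \<sigma>\<^sup>2)) * l2sq f"
proof -
  define G where "G = (\<lambda>p q. ennreal (exp (- (\<sigma>\<^sup>2 * (p - q)\<^sup>2 / 2))))"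
  have [measurable]: "case_prod G \<in> borel_measurable (lborel \<Otimes>\<^sub>M lborel)"
    unfolding G_def by measurable
  define F where "F = (\<lambda>p. ennreal ((cmod (f p))\<^sup>2))"
  have [measurable]: "F \<in> borel_measurable borel"
    unfolding F_def by measurable
  have Gsym: "G p q = G q p" for p q by (simp add: G_def power2_commute)
  have Gint: "(\<integral>\<^sup>+ q. G p q \<partial>lborel) = ennreal (sqrt (2 * pi / \<sigma>\<^sup>2))" for p
    unfolding G_def by (rule nn_integral_gaussian[OF \<sigma>])
  define r where "r = (1/2::real)"
  have r: "r \<ge> 0" by (simp add: r_def)
  have am: "ennreal (cmod (f (fst z)) * cmod (f (snd z)) * exp (- (\<sigma>\<^sup>2 * (fst z - snd z)\<^sup>2 / 2)))
      \<le> ennreal (r) * (F (fst z) * G (fst z) (snd z)) + ennreal (r) * (F (snd z) * G (fst z) (snd z))" for z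
  proof -
    have "cmod (f (fst z)) * cmod (f (snd z)) \<le> r * (cmod (f (fst z)))\<^sup>2 + r * (cmod (f (snd z)))\<^sup>2"
      using sum_squares_bound[of "cmod (f (fst z))" "cmod (f (snd z))"] by (simp add: r_def)
    then have "cmod (f (fst z)) * cmod (f (snd z)) * exp (- (\<sigma>\<^sup>2 * (fst z - snd z)\<^sup>2 / 2))
       \<le> (r * (cmod (f (fst z)))\<^sup>2 + r * (cmod (f (snd z)))\<^sup>2) * exp (- (\<sigma>\<^sup>2 * (fst z - snd z)\<^sup>2 / 2))"
      by (rule mult_right_mono) simp
    then have "ennreal (cmod (f (fst z)) * cmod (f (snd z)) * exp (- (\<sigma>\<^sup>2 * (fst z - snd z)\<^sup>2 / 2)))
       \<le> ennreal ((r * (cmod (f (fst z)))\<^sup>2 + r * (cmod (f (snd z)))\<^sup>2) * exp (- (\<sigma>\<^sup>2 * (fst z - snd z)\<^sup>2 / 2)))"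
      by (rule ennreal_leI)
    also have "\<dots> = ennreal (r) * (F (fst z) * G (fst z) (snd z)) + ennreal (r) * (F (snd z) * G (fst z) (snd z))"
      unfolding F_def G_def using r by (simp add: ring_distribs mult.assoc flip: ennreal_mult ennreal_plus)
    finally show ?thesis .
  qed
  have "(\<integral>\<^sup>+ z. F (fst z) * G (fst z) (snd z) \<partial>(lborel \<Otimes>\<^sub>M lborel))
      = (\<integral>\<^sup>+ p. \<integral>\<^sup>+ q. F p * G p q \<partial>lborel \<partial>lborel)"
    by (subst lborel.nn_integral_fst[symmetric]) simp_all
  also have "\<dots> = ennreal (sqrt (2 * pi / \<sigma>\<^sup>2)) * l2sq f"
    by (simp add: nn_integral_cmult Gint nn_integral_multc l2sq_def F_def[symmetric] mult.commute)
  finally have 1: "(\<integral>\<^sup>+ z. F (fst z) * G (fst z) (snd z) \<partial>(lborel \<Otimes>\<^sub>M lborel))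
      = ennreal (sqrt (2 * pi / \<sigma>\<^sup>2)) * l2sq f" .
  have "(\<integral>\<^sup>+ z. F (snd z) * G (fst z) (snd z) \<partial>(lborel \<Otimes>\<^sub>M lborel))
      = (\<integral>\<^sup>+ q. \<integral>\<^sup>+ p. F q * G p q \<partial>lborel \<partial>lborel)"
    by (subst lborel_pair.nn_integral_snd[symmetric]) simp_all
  also have "\<dots> = (\<integral>\<^sup>+ q. \<integral>\<^sup>+ p. F q * G q p \<partial>lborel \<partial>lborel)"
    by (subst Gsym) simp
  also have "\<dots> = ennreal (sqrt (2 * pi / \<sigma>\<^sup>2)) * l2sq f"
    by (simp add: nn_integral_cmult Gint nn_integral_multc l2sq_def F_def[symmetric] mult.commute)
  finally have 2: "(\<integral>\<^sup>+ z. F (snd z) * G (fst z) (snd z) \<partial>(lborel \<Otimes>\<^sub>M lborel))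
      = ennreal (sqrt (2 * pi / \<sigma>\<^sup>2)) * l2sq f" .
  have "(\<integral>\<^sup>+ z. ennreal (cmod (f (fst z)) * cmod (f (snd z)) * exp (- (\<sigma>\<^sup>2 * (fst z - snd z)\<^sup>2 / 2)))
            \<partial>(lborel \<Otimes>\<^sub>M lborel))
     \<le> (\<integral>\<^sup>+ z. ennreal r * (F (fst z) * G (fst z) (snd z)) + ennreal r * (F (snd z) * G (fst z) (snd z))
            \<partial>(lborel \<Otimes>\<^sub>M lborel))"
    by (intro nn_integral_mono am)
  also have "\<dots> = ennreal r * (ennreal (sqrt (2 * pi / \<sigma>\<^sup>2)) * l2sq f)
       + ennreal r * (ennreal (sqrt (2 * pi / \<sigma>\<^sup>2)) * l2sq f)"
    by (subst nn_integral_add) (simp_all add: nn_integral_cmult 1 2)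
  also have "\<dots> = (ennreal r + ennreal r) * (ennreal (sqrt (2 * pi / \<sigma>\<^sup>2)) * l2sq f)"
    by (simp only: distrib_right)
  also have "ennreal r + ennreal r = 1"
    by (subst ennreal_plus[symmetric]) (simp_all add: r_def)
  finally show ?thesis by simp
qed

lemma l2sq_ft_damped_le:
  assumes f: "integrable lborel f" and \<sigma>: "\<sigma> > 0"
  shows "(\<integral>\<^sup>+ \<eta>. ennreal (exp (- (\<eta>\<^sup>2 / (2 * \<sigma>\<^sup>2))) * (cmod (ft f \<eta>))\<^sup>2) \<partial>lborel) \<le> ennreal (2 * pi) * l2sq f"
proof -
  have [measurable]: "f \<in> borel_measurable borel" using f by auto
  define c where "c = sqrt (2 * pi * \<sigma>\<^sup>2)"
  have c0: "c \<ge> 0" by (simp add: c_def)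
  have cc: "c * sqrt (2 * pi / \<sigma>\<^sup>2) = 2 * pi"
  proof -
    have "2 * pi * \<sigma>\<^sup>2 * (2 * pi / \<sigma>\<^sup>2) = (2 * pi)\<^sup>2"
      using \<sigma> by (simp add: power2_eq_square)
    then show ?thesis
      unfolding c_def real_sqrt_mult[symmetric] by (simp only: real_sqrt_abs) simp
  qed
  have e: "exp (- (\<eta>\<^sup>2 / (2 * \<sigma>\<^sup>2))) = c * normal_density 0 \<sigma> \<eta>" for \<eta>
    using \<sigma> by (simp add: normal_density_def c_def)
  have int: "integrable lborel (\<lambda>\<eta>. normal_density 0 \<sigma> \<eta> * (cmod (ft f \<eta>))\<^sup>2)"
  proof (rule Bochner_Integration.integrable_bound)
    show "integrable lborel (\<lambda>\<eta>. normal_density 0 \<sigma> \<eta> * (LBINT t. cmod (f t))\<^sup>2)"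
      using \<sigma> by (intro integrable_mult_left) auto
  qed (auto intro!: mult_left_mono power_mono norm_ft_le)
  have intP: "integrable (lborel \<Otimes>\<^sub>M lborel) (\<lambda>z. f (fst z) * cnj (f (snd z)) * cis (- (0 * fst z - 0 * snd z))
       * of_real (exp (- (\<sigma>\<^sup>2 * (fst z - snd z)\<^sup>2 / 2))))"
  proof (rule Bochner_Integration.integrable_bound)
    show "integrable (lborel \<Otimes>\<^sub>M lborel) (\<lambda>z. f (fst z) * cnj (f (snd z)))"
      using integrable_tensor[OF f integrable_cnj[OF f]] by (simp add: case_prod_unfold)
  qed (auto simp: norm_mult intro!: mult_left_le)
  have "of_real (LBINT \<eta>. normal_density 0 \<sigma> \<eta> * (cmod (ft f \<eta>))\<^sup>2)
      = (LBINT \<eta>. of_real (normal_density 0 \<sigma> \<eta>) * (ft f (0 + \<eta>) * cnj (ft f (0 + \<eta>))))"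
    by (simp flip: integral_complex_of_real complex_norm_square)
  also have "\<dots> = (\<integral>z. f (fst z) * cnj (f (snd z)) * cis (- (0 * fst z - 0 * snd z))
       * of_real (exp (- (\<sigma>\<^sup>2 * (fst z - snd z)\<^sup>2 / 2))) \<partial>(lborel \<Otimes>\<^sub>M lborel))"
    unfolding integral_normal_density_ft[OF f f \<sigma>] case_prod_unfold ..
  finally have eq: "complex_of_real (LBINT \<eta>. normal_density 0 \<sigma> \<eta> * (cmod (ft f \<eta>))\<^sup>2) = \<dots>" .
  have "(\<integral>\<^sup>+ \<eta>. ennreal (normal_density 0 \<sigma> \<eta> * (cmod (ft f \<eta>))\<^sup>2) \<partial>lborel)
     = ennreal (LBINT \<eta>. normal_density 0 \<sigma> \<eta> * (cmod (ft f \<eta>))\<^sup>2)"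
    by (rule nn_integral_eq_integral[OF int]) simp
  also have "\<dots> \<le> ennreal (cmod (complex_of_real (LBINT \<eta>. normal_density 0 \<sigma> \<eta> * (cmod (ft f \<eta>))\<^sup>2)))"
    by (rule ennreal_leI) simp
  also have "\<dots> \<le> (\<integral>\<^sup>+ z. ennreal (cmod (f (fst z) * cnj (f (snd z)) * cis (- (0 * fst z - 0 * snd z))
       * of_real (exp (- (\<sigma>\<^sup>2 * (fst z - snd z)\<^sup>2 / 2))))) \<partial>(lborel \<Otimes>\<^sub>M lborel))"
    unfolding eq by (rule integral_norm_bound_ennreal[OF intP])
  also have "\<dots> = (\<integral>\<^sup>+ z. ennreal (cmod (f (fst z)) * cmod (f (snd z)) * exp (- (\<sigma>\<^sup>2 * (fst z - snd z)\<^sup>2 / 2)))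
            \<partial>(lborel \<Otimes>\<^sub>M lborel))"
    by (simp add: norm_mult)
  also have "\<dots> \<le> ennreal (sqrt (2 * pi / \<sigma>\<^sup>2)) * l2sq f"
    using \<sigma> by (intro nn_integral_gaussian_product_le) auto
  finally have le: "(\<integral>\<^sup>+ \<eta>. ennreal (normal_density 0 \<sigma> \<eta> * (cmod (ft f \<eta>))\<^sup>2) \<partial>lborel) \<le> \<dots>" .
  have "(\<integral>\<^sup>+ \<eta>. ennreal (exp (- (\<eta>\<^sup>2 / (2 * \<sigma>\<^sup>2))) * (cmod (ft f \<eta>))\<^sup>2) \<partial>lborel)
      = ennreal c * (\<integral>\<^sup>+ \<eta>. ennreal (normal_density 0 \<sigma> \<eta> * (cmod (ft f \<eta>))\<^sup>2) \<partial>lborel)"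
    unfolding e mult.assoc using c0 by (simp add: ennreal_mult' nn_integral_cmult)
  also have "\<dots> \<le> ennreal c * (ennreal (sqrt (2 * pi / \<sigma>\<^sup>2)) * l2sq f)"
    by (rule mult_left_mono[OF le]) simp
  also have "\<dots> = ennreal (2 * pi) * l2sq f"
    by (simp add: cc c0 flip: mult.assoc ennreal_mult')
  finally show ?thesis .
qed

text \<open>The Plancherel inequality; the converse inequality is not needed.  The bounds for the damped
  transform are uniform in \<open>\<sigma>\<close>, and Fatou's lemma removes the damping as \<open>\<sigma>\<close> tends to \<open>\<infinity>\<close>.\<close>

theorem l2sq_ft_le:
  assumes f: "integrable lborel f"
  shows "l2sq (ft f) \<le> ennreal (2 * pi) * l2sq f"
proof -
  have [measurable]: "f \<in> borel_measurable borel" using f by auto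
  define w where "w = (\<lambda>n \<eta>. exp (- (\<eta>\<^sup>2 / (2 * (real (Suc n))\<^sup>2))) * (cmod (ft f \<eta>))\<^sup>2)"
  have "((\<lambda>n. w n \<eta>) \<longlongrightarrow> exp (- 0) * (cmod (ft f \<eta>))\<^sup>2) sequentially" for \<eta>
  proof -
    have "(\<lambda>n. \<eta>\<^sup>2 / (2 * (real (Suc n))\<^sup>2)) \<longlonglongrightarrow> 0" by real_asymp
    then show ?thesis unfolding w_def by (intro tendsto_intros)
  qed
  then have lim: "liminf (\<lambda>n. ennreal (w n \<eta>)) = ennreal ((cmod (ft f \<eta>))\<^sup>2)" for \<eta>
    by (intro lim_imp_Liminf tendsto_ennrealI) simp_all
  have "l2sq (ft f) = (\<integral>\<^sup>+ \<eta>. liminf (\<lambda>n. ennreal (w n \<eta>)) \<partial>lborel)"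
    by (simp add: l2sq_def lim)
  also have "\<dots> \<le> liminf (\<lambda>n. \<integral>\<^sup>+ \<eta>. ennreal (w n \<eta>) \<partial>lborel)"
    by (rule nn_integral_liminf) (simp add: w_def)
  also have "\<dots> \<le> ennreal (2 * pi) * l2sq f"
    unfolding w_def by (intro Liminf_le always_eventually allI l2sq_ft_damped_le f) auto
  finally show ?thesis .
qed

section \<open>The ambiguity function of an integrable signal\<close>

text \<open>The map \<open>(\<tau>, t) \<mapsto> (t + a * \<tau>, t - a * \<tau>)\<close> has Jacobian \<open>2 * a\<close> in absolute value.\<close>

lemma distr_shear:
  fixes a :: real
  assumes a: "a > 0"
  shows "distr (lborel \<Otimes>\<^sub>M lborel) (lborel \<Otimes>\<^sub>M lborel) (\<lambda>(\<tau>, t). (t + a * \<tau>, t - a * \<tau>))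
    = density (lborel \<Otimes>\<^sub>M lborel) (\<lambda>_. ennreal (1 / (2 * a)))"
proof (rule measure_eqI)
  fix A assume "A \<in> sets (distr (lborel \<Otimes>\<^sub>M lborel) (lborel \<Otimes>\<^sub>M lborel)
                 (\<lambda>(\<tau>, t). (t + a * \<tau>, t - a * \<tau>)) :: (real \<times> real) measure)"
  then have A [measurable]: "A \<in> sets (borel \<Otimes>\<^sub>M borel :: (real \<times> real) measure)"
    by (simp cong: sets_pair_measure_cong)
  have A' [measurable]: "A \<in> sets (lborel \<Otimes>\<^sub>M lborel :: (real \<times> real) measure)"
    using A by (simp cong: sets_pair_measure_cong)
  have "emeasure (distr (lborel \<Otimes>\<^sub>M lborel) (lborel \<Otimes>\<^sub>M lborel) (\<lambda>(\<tau>, t). (t + a * \<tau>, t - a * \<tau>))) A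
      = (\<integral>\<^sup>+ z. indicator A z \<partial>distr (lborel \<Otimes>\<^sub>M lborel) (lborel \<Otimes>\<^sub>M lborel) (\<lambda>(\<tau>, t). (t + a * \<tau>, t - a * \<tau>)))"
    by simp
  also have "\<dots> = (\<integral>\<^sup>+ z. indicator A (case z of (\<tau>, t) \<Rightarrow> (t + a * \<tau>, t - a * \<tau>)) \<partial>(lborel \<Otimes>\<^sub>M lborel))"
    by (subst nn_integral_distr) simp_all
  also have "\<dots> = (\<integral>\<^sup>+ \<tau>. \<integral>\<^sup>+ t. indicator A (t + a * \<tau>, t - a * \<tau>) \<partial>lborel \<partial>lborel)"
    by (subst lborel.nn_integral_fst[symmetric]) simp_all
  also have "\<dots> = (\<integral>\<^sup>+ \<tau>. \<integral>\<^sup>+ q. indicator A (q + 2 * a * \<tau>, q) \<partial>lborel \<partial>lborel)"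
  proof (rule nn_integral_cong)
    fix \<tau> :: real
    show "(\<integral>\<^sup>+ t. indicator A (t + a * \<tau>, t - a * \<tau>) \<partial>lborel) = (\<integral>\<^sup>+ q. indicator A (q + 2 * a * \<tau>, q) \<partial>lborel)"
      using nn_integral_lborel_affine[of "\<lambda>q. indicator A (q + 2 * a * \<tau>, q)" 1 "- a * \<tau>"]
      by (simp add: algebra_simps)
  qed
  also have "\<dots> = (\<integral>\<^sup>+ q. \<integral>\<^sup>+ \<tau>. indicator A (q + 2 * a * \<tau>, q) \<partial>lborel \<partial>lborel)"
    by (rule lborel_pair.Fubini'[symmetric]) measurable
  also have "\<dots> = (\<integral>\<^sup>+ q. ennreal (1 / (2 * a)) * \<integral>\<^sup>+ p. indicator A (p, q) \<partial>lborel \<partial>lborel)"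
    using a by (subst nn_integral_lborel_affine[of "\<lambda>p. indicator A (p, q)" "2 * a" q for q]) simp_all
  also have "\<dots> = ennreal (1 / (2 * a)) * (\<integral>\<^sup>+ z. indicator A z \<partial>(lborel \<Otimes>\<^sub>M lborel))"
    by (subst nn_integral_cmult) (simp_all add: lborel_pair.nn_integral_snd)
  also have "\<dots> = emeasure (density (lborel \<Otimes>\<^sub>M lborel) (\<lambda>_. ennreal (1 / (2 * a)))) A"
    by (simp add: emeasure_density nn_integral_cmult)
  finally show "emeasure (distr (lborel \<Otimes>\<^sub>M lborel) (lborel \<Otimes>\<^sub>M lborel) (\<lambda>(\<tau>, t). (t + a * \<tau>, t - a * \<tau>))) A
      = emeasure (density (lborel \<Otimes>\<^sub>M lborel) (\<lambda>_. ennreal (1 / (2 * a)))) A" .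
qed simp

lemma integral_shear:
  fixes h :: "real \<Rightarrow> real \<Rightarrow> complex"
  assumes a: "a > 0" and h: "integrable (lborel \<Otimes>\<^sub>M lborel) (\<lambda>(p, q). h p q)"
  shows "integrable (lborel \<Otimes>\<^sub>M lborel) (\<lambda>(\<tau>, t). h (t + a * \<tau>) (t - a * \<tau>))"
    and "(\<integral>(\<tau>, t). h (t + a * \<tau>) (t - a * \<tau>) \<partial>(lborel \<Otimes>\<^sub>M lborel))
        = of_real (1 / (2 * a)) * (\<integral>(p, q). h p q \<partial>(lborel \<Otimes>\<^sub>M lborel))"
proof -
  have [measurable]: "(\<lambda>(p, q). h p q) \<in> borel_measurable (lborel \<Otimes>\<^sub>M lborel)" using h by auto
  let ?L = "\<lambda>(\<tau>, t). (t + a * \<tau>, t - a * \<tau>)"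
  let ?D = "density (lborel \<Otimes>\<^sub>M lborel :: (real \<times> real) measure) (\<lambda>_. ennreal (1 / (2 * a)))"
  have L: "?L \<in> (lborel \<Otimes>\<^sub>M lborel) \<rightarrow>\<^sub>M (lborel \<Otimes>\<^sub>M lborel)" by simp
  have "integrable ?D (\<lambda>(p, q). h p q)"
    using a h by (subst integrable_density) (auto intro!: integrable_scaleR_right)
  then have "integrable (lborel \<Otimes>\<^sub>M lborel) (\<lambda>z. case ?L z of (p, q) \<Rightarrow> h p q)"
    by (intro integrable_distr[OF L]) (simp only: distr_shear[OF a])
  then show "integrable (lborel \<Otimes>\<^sub>M lborel) (\<lambda>(\<tau>, t). h (t + a * \<tau>) (t - a * \<tau>))"
    by (simp add: case_prod_unfold)
  have "(\<integral>z. (case ?L z of (p, q) \<Rightarrow> h p q) \<partial>(lborel \<Otimes>\<^sub>M lborel)) = (\<integral>(p, q). h p q \<partial>?D)"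
    by (subst distr_shear[OF a, symmetric], subst integral_distr[OF L]) simp_all
  also have "\<dots> = of_real (1 / (2 * a)) * (\<integral>(p, q). h p q \<partial>(lborel \<Otimes>\<^sub>M lborel))"
    using a by (subst integral_density) (simp_all add: scaleR_conv_of_real)
  finally show "(\<integral>(\<tau>, t). h (t + a * \<tau>) (t - a * \<tau>) \<partial>(lborel \<Otimes>\<^sub>M lborel))
        = of_real (1 / (2 * a)) * (\<integral>(p, q). h p q \<partial>(lborel \<Otimes>\<^sub>M lborel))"
    by (simp add: case_prod_unfold)
qed

text \<open>The classical ambiguity function at delay \<open>\<tau>\<close> and frequency \<open>v\<close>, with the delay scaled by \<open>a\<close>
  (classically \<open>a = 1 / 2\<close>).\<close>

definition amb :: "real \<Rightarrow> (real \<Rightarrow> complex) \<Rightarrow> real \<Rightarrow> real \<Rightarrow> complex" where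
  "amb a y \<tau> v = (LBINT t. y (t + a * \<tau>) * cnj (y (t - a * \<tau>)) * cis (- (v * t)))"

text \<open>The case \<open>\<epsilon> = 0\<close> is included, so that one substitution serves both the plain and the damped
  marginal.  The phase is written as \<open>a * p - b * q\<close> with \<open>a = v / 2\<close>, \<open>b = - (v / 2)\<close>, the shape in which
  products of Fourier transforms appear.\<close>

lemma amb_damped_marginal:
  assumes y: "integrable lborel y" and a: "a > 0" and \<epsilon>: "\<epsilon> \<ge> 0"
  shows "integrable lborel (\<lambda>\<tau>. of_real (exp (- \<epsilon> * \<tau>\<^sup>2)) * amb a y \<tau> v)"
    and "(LBINT \<tau>. of_real (exp (- \<epsilon> * \<tau>\<^sup>2)) * amb a y \<tau> v) = of_real (1 / (2 * a)) *
      (\<integral>(p, q). y p * cnj (y q) * cis (- (v / 2 * p - (- (v / 2)) * q))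
          * of_real (exp (- \<epsilon> * ((p - q) / (2 * a))\<^sup>2)) \<partial>(lborel \<Otimes>\<^sub>M lborel))"
proof -
  have [measurable]: "y \<in> borel_measurable borel" using y by auto
  define h where "h = (\<lambda>p q. y p * cnj (y q) * cis (- (v / 2 * p - (- (v / 2)) * q))
          * of_real (exp (- \<epsilon> * ((p - q) / (2 * a))\<^sup>2)))"
  have [measurable]: "(\<lambda>(p, q). h p q) \<in> borel_measurable (lborel \<Otimes>\<^sub>M lborel)"
    unfolding h_def case_prod_unfold by measurable
  have hi: "integrable (lborel \<Otimes>\<^sub>M lborel) (\<lambda>(p, q). h p q)"
  proof (rule Bochner_Integration.integrable_bound)
    show "integrable (lborel \<Otimes>\<^sub>M lborel) (\<lambda>(p, q). y p * cnj (y q))"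
      by (rule integrable_tensor[OF y integrable_cnj[OF y]])
    show "AE z in lborel \<Otimes>\<^sub>M lborel. norm (case z of (p, q) \<Rightarrow> h p q)
        \<le> norm (case z of (p, q) \<Rightarrow> y p * cnj (y q))"
      using \<epsilon> by (intro AE_I2) (auto simp: norm_mult h_def intro!: mult_left_le)
  qed measurable
  have h: "h (t + a * \<tau>) (t - a * \<tau>)
      = of_real (exp (- \<epsilon> * \<tau>\<^sup>2)) * (y (t + a * \<tau>) * cnj (y (t - a * \<tau>)) * cis (- (v * t)))" for \<tau> t
  proof -
    have "(t + a * \<tau> - (t - a * \<tau>)) / (2 * a) = \<tau>"
      "v / 2 * (t + a * \<tau>) - (- (v / 2)) * (t - a * \<tau>) = v * t"
      using a by (simp_all add: field_simps)
    then show ?thesis unfolding h_def by (simp only: mult_ac)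
  qed
  have s: "integrable (lborel \<Otimes>\<^sub>M lborel) (\<lambda>(\<tau>, t).
      of_real (exp (- \<epsilon> * \<tau>\<^sup>2)) * (y (t + a * \<tau>) * cnj (y (t - a * \<tau>)) * cis (- (v * t))))"
    "(\<integral>(\<tau>, t). of_real (exp (- \<epsilon> * \<tau>\<^sup>2)) * (y (t + a * \<tau>) * cnj (y (t - a * \<tau>)) * cis (- (v * t)))
       \<partial>(lborel \<Otimes>\<^sub>M lborel)) = of_real (1 / (2 * a)) * (\<integral>(p, q). h p q \<partial>(lborel \<Otimes>\<^sub>M lborel))"
    using integral_shear[OF a hi] unfolding h by blast+
  show "integrable lborel (\<lambda>\<tau>. of_real (exp (- \<epsilon> * \<tau>\<^sup>2)) * amb a y \<tau> v)"
    using lborel_pair.integrable_fst'[OF s(1)] by (simp add: amb_def)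
  show "(LBINT \<tau>. of_real (exp (- \<epsilon> * \<tau>\<^sup>2)) * amb a y \<tau> v) = of_real (1 / (2 * a)) *
      (\<integral>(p, q). y p * cnj (y q) * cis (- (v / 2 * p - (- (v / 2)) * q))
          * of_real (exp (- \<epsilon> * ((p - q) / (2 * a))\<^sup>2)) \<partial>(lborel \<Otimes>\<^sub>M lborel))"
    using lborel_pair.integral_fst'[OF s(1)] s(2) by (simp add: amb_def h_def)
qed

lemma amb_marginal:
  assumes y: "integrable lborel y" and a: "a > 0"
  shows "integrable lborel (\<lambda>\<tau>. amb a y \<tau> v)"
    and "(LBINT \<tau>. amb a y \<tau> v) = of_real (1 / (2 * a)) * (ft y (v / 2) * cnj (ft y (- (v / 2))))"
  using amb_damped_marginal[OF y a, of 0 v] unfolding ft_mult_cnj_ft[OF y y] by simp_all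

text \<open>The standard deviation is chosen to satisfy \<open>\<sigma>\<^sup>2 / 2 = \<epsilon> / (2 * a)\<^sup>2\<close>.\<close>

lemma amb_damped_marginal_ft:
  assumes y: "integrable lborel y" and a: "a > 0" and \<epsilon>: "\<epsilon> > 0"
  shows "(LBINT \<tau>. of_real (exp (- \<epsilon> * \<tau>\<^sup>2)) * amb a y \<tau> v) = of_real (1 / (2 * a)) *
      (LBINT \<eta>. of_real (normal_density 0 (sqrt (2 * \<epsilon>) / (2 * a)) \<eta>)
          * (ft y (v / 2 + \<eta>) * cnj (ft y (- (v / 2) + \<eta>))))"
proof -
  have \<sigma>: "sqrt (2 * \<epsilon>) / (2 * a) > 0" using a \<epsilon> by simp
  have "- ((sqrt (2 * \<epsilon>) / (2 * a))\<^sup>2 * (p - q)\<^sup>2 / 2) = - \<epsilon> * ((p - q) / (2 * a))\<^sup>2" for p q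
    using \<epsilon> by (simp add: power_divide)
  then show ?thesis
    unfolding integral_normal_density_ft[OF y y \<sigma>]
    using amb_damped_marginal(2)[OF y a, of \<epsilon> v] \<epsilon> by simp
qed

section \<open>Translations of the Fourier transform in mean square\<close>

lemma l2sq_affine:
  assumes [measurable]: "F \<in> borel_measurable borel" and "c \<noteq> 0"
  shows "l2sq (\<lambda>u. F (b + c * u)) = ennreal (1 / \<bar>c\<bar>) * l2sq F"
  unfolding l2sq_def using assms
  by (subst nn_integral_lborel_affine[of "\<lambda>u. ennreal ((cmod (F u))\<^sup>2)"]) auto

lemma mult_le_weighted_squares:
  fixes a b \<delta> :: real
  assumes "\<delta> > 0"
  shows "a * b \<le> \<delta> / 2 * a\<^sup>2 + 1 / (2 * \<delta>) * b\<^sup>2"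
proof -
  have "0 \<le> (\<delta> * a - b)\<^sup>2 / (2 * \<delta>)" using assms by simp
  also have "\<dots> = \<delta> / 2 * a\<^sup>2 + 1 / (2 * \<delta>) * b\<^sup>2 - a * b"
    using assms by (simp add: power2_diff field_simps power2_eq_square)
  finally show ?thesis by simp
qed

lemma norm_product_diff_le:
  assumes \<delta>: "\<delta> > 0"
  shows "cmod (P * cnj Q - P0 * cnj Q0)
    \<le> \<delta> / 2 * ((cmod Q)\<^sup>2 + (cmod P0)\<^sup>2) + 1 / (2 * \<delta>) * ((cmod (P - P0))\<^sup>2 + (cmod (Q - Q0))\<^sup>2)"
proof -
  have "P * cnj Q - P0 * cnj Q0 = cnj Q * (P - P0) + P0 * cnj (Q - Q0)"
    by (simp add: algebra_simps)
  then have "cmod (P * cnj Q - P0 * cnj Q0) \<le> cmod Q * cmod (P - P0) + cmod P0 * cmod (Q - Q0)"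
    by (metis complex_mod_cnj norm_mult norm_triangle_ineq)
  also have "\<dots> \<le> (\<delta> / 2 * (cmod Q)\<^sup>2 + 1 / (2 * \<delta>) * (cmod (P - P0))\<^sup>2)
                + (\<delta> / 2 * (cmod P0)\<^sup>2 + 1 / (2 * \<delta>) * (cmod (Q - Q0))\<^sup>2)"
    by (intro add_mono mult_le_weighted_squares \<delta>)
  finally show ?thesis by (simp add: algebra_simps)
qed

text \<open>An \<open>L\<^sup>1\<close> estimate for differences of products.  The free weight \<open>\<delta>\<close> replaces the Cauchy-Schwarz
  inequality, so only squared norms occur.\<close>

lemma nn_integral_product_diff_le:
  assumes \<delta>: "\<delta> > 0"
    and [measurable]: "P \<in> borel_measurable borel" "Q \<in> borel_measurable borel"
      "P0 \<in> borel_measurable borel" "Q0 \<in> borel_measurable borel"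
  shows "(\<integral>\<^sup>+ u. ennreal (cmod (P u * cnj (Q u) - P0 u * cnj (Q0 u))) \<partial>lborel)
    \<le> ennreal (\<delta> / 2) * (l2sq Q + l2sq P0)
      + ennreal (1 / (2 * \<delta>)) * (l2sq (\<lambda>u. P u - P0 u) + l2sq (\<lambda>u. Q u - Q0 u))"
proof -
  have "(\<integral>\<^sup>+ u. ennreal (cmod (P u * cnj (Q u) - P0 u * cnj (Q0 u))) \<partial>lborel)
    \<le> (\<integral>\<^sup>+ u. ennreal (\<delta> / 2) * (ennreal ((cmod (Q u))\<^sup>2) + ennreal ((cmod (P0 u))\<^sup>2))
       + ennreal (1 / (2 * \<delta>)) * (ennreal ((cmod (P u - P0 u))\<^sup>2) + ennreal ((cmod (Q u - Q0 u))\<^sup>2)) \<partial>lborel)"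
  proof (rule nn_integral_mono)
    fix u
    have "ennreal (cmod (P u * cnj (Q u) - P0 u * cnj (Q0 u))) \<le>
      ennreal (\<delta> / 2 * ((cmod (Q u))\<^sup>2 + (cmod (P0 u))\<^sup>2)
         + 1 / (2 * \<delta>) * ((cmod (P u - P0 u))\<^sup>2 + (cmod (Q u - Q0 u))\<^sup>2))"
      by (rule ennreal_leI[OF norm_product_diff_le[OF \<delta>]])
    also have "\<dots> = ennreal (\<delta> / 2) * (ennreal ((cmod (Q u))\<^sup>2) + ennreal ((cmod (P0 u))\<^sup>2))
       + ennreal (1 / (2 * \<delta>)) * (ennreal ((cmod (P u - P0 u))\<^sup>2) + ennreal ((cmod (Q u - Q0 u))\<^sup>2))"
    proof -
      have "0 \<le> \<delta> / 2" "0 \<le> 1 / (2 * \<delta>)" using \<delta> by simp_all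
      then show ?thesis
        by (simp only: ennreal_plus mult_nonneg_nonneg add_nonneg_nonneg zero_le_power2 ennreal_mult')
    qed
    finally show "ennreal (cmod (P u * cnj (Q u) - P0 u * cnj (Q0 u))) \<le> \<dots>" .
  qed
  also have "\<dots> = ennreal (\<delta> / 2) * (l2sq Q + l2sq P0)
      + ennreal (1 / (2 * \<delta>)) * (l2sq (\<lambda>u. P u - P0 u) + l2sq (\<lambda>u. Q u - Q0 u))"
    unfolding l2sq_def by (simp add: nn_integral_add nn_integral_cmult)
  finally show ?thesis .
qed

lemma norm_cis_minus_1: "(cmod (cis x - 1))\<^sup>2 = 2 - 2 * cos x"
proof -
  have "(cmod (cis x - 1))\<^sup>2 = (cos x - 1)\<^sup>2 + (sin x)\<^sup>2" by (simp add: cmod_power2)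
  also have "\<dots> = ((sin x)\<^sup>2 + (cos x)\<^sup>2) - 2 * cos x + 1" by (simp only: power2_diff) simp
  finally show ?thesis by simp
qed

lemma nn_integral_normal_density_cis_minus_1:
  assumes \<sigma>: "\<sigma> > 0"
  shows "(\<integral>\<^sup>+ \<eta>. ennreal (normal_density 0 \<sigma> \<eta> * (cmod (cis (- (\<eta> * t)) - 1))\<^sup>2) \<partial>lborel)
    = ennreal (2 - 2 * exp (- (\<sigma>\<^sup>2 * t\<^sup>2 / 2)))"
proof -
  have i: "integrable lborel (\<lambda>\<eta>. of_real (normal_density 0 \<sigma> \<eta>) * cis (- (\<eta> * t)))"
    using \<sigma> by (intro integrable_mult_cis) auto
  have eq: "normal_density 0 \<sigma> \<eta> * (cmod (cis (- (\<eta> * t)) - 1))\<^sup>2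
      = 2 * normal_density 0 \<sigma> \<eta> - 2 * Re (of_real (normal_density 0 \<sigma> \<eta>) * cis (- (\<eta> * t)))" for \<eta>
    unfolding norm_cis_minus_1 by (simp add: algebra_simps)
  have int: "integrable lborel (\<lambda>\<eta>. normal_density 0 \<sigma> \<eta> * (cmod (cis (- (\<eta> * t)) - 1))\<^sup>2)"
    unfolding eq using \<sigma> i
    by (intro Bochner_Integration.integrable_diff integrable_mult_right integrable_Re) auto
  have "(LBINT \<eta>. normal_density 0 \<sigma> \<eta> * (cmod (cis (- (\<eta> * t)) - 1))\<^sup>2)
     = 2 * (LBINT \<eta>. normal_density 0 \<sigma> \<eta>)
       - 2 * Re (LBINT \<eta>. of_real (normal_density 0 \<sigma> \<eta>) * cis (- (\<eta> * t)))"
    unfolding eq using \<sigma> i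
    by (subst Bochner_Integration.integral_diff)
       (auto simp del: Re_complex_of_real complex_Re_of_nat times_complex.sel simp: integral_Re
          intro!: integrable_mult_right integrable_Re)
  also have "\<dots> = 2 - 2 * exp (- (\<sigma>\<^sup>2 * t\<^sup>2 / 2))"
    using \<sigma> by (simp add: integral_normal_density_cis)
  finally show ?thesis
    by (subst nn_integral_eq_integral[OF int]) auto
qed

text \<open>The mean square, over a Gaussian translation of standard deviation \<open>\<sigma>\<close>, of the \<open>L\<^sup>2\<close> norm of
  \<open>f t * cis (- (\<eta> * t)) - f t\<close>, already integrated over \<open>\<eta>\<close>.\<close>

definition osc :: "real \<Rightarrow> (real \<Rightarrow> complex) \<Rightarrow> ennreal" where
  "osc \<sigma> f = (\<integral>\<^sup>+ t. ennreal ((2 - 2 * exp (- (\<sigma>\<^sup>2 * t\<^sup>2 / 2))) * (cmod (f t))\<^sup>2) \<partial>lborel)"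

lemma l2sq_ft_translate_le:
  assumes f: "integrable lborel f"
  shows "l2sq (\<lambda>\<xi>. ft f (\<eta> + \<xi>) - ft f \<xi>)
    \<le> ennreal (2 * pi) * (\<integral>\<^sup>+ t. ennreal ((cmod (cis (- (\<eta> * t)) - 1))\<^sup>2 * (cmod (f t))\<^sup>2) \<partial>lborel)"
proof -
  have i: "integrable lborel (\<lambda>t. f t * cis (- (\<eta> * t)))"
    by (intro integrable_mult_cis f) auto
  have "l2sq (\<lambda>\<xi>. ft f (\<eta> + \<xi>) - ft f \<xi>) = l2sq (ft (\<lambda>t. f t * cis (- (\<eta> * t)) - f t))"
    by (intro arg_cong[where f=l2sq] ext) (simp only: ft_diff[OF i f] ft_modulate)
  also have "\<dots> \<le> ennreal (2 * pi) * l2sq (\<lambda>t. f t * cis (- (\<eta> * t)) - f t)"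
    by (intro l2sq_ft_le Bochner_Integration.integrable_diff i f)
  also have "l2sq (\<lambda>t. f t * cis (- (\<eta> * t)) - f t)
     = (\<integral>\<^sup>+ t. ennreal ((cmod (cis (- (\<eta> * t)) - 1))\<^sup>2 * (cmod (f t))\<^sup>2) \<partial>lborel)"
    unfolding l2sq_def
  proof (intro nn_integral_cong arg_cong[where f=ennreal])
    fix t
    have "f t * cis (- (\<eta> * t)) - f t = (cis (- (\<eta> * t)) - 1) * f t" by (simp add: algebra_simps)
    then show "(cmod (f t * cis (- (\<eta> * t)) - f t))\<^sup>2 = (cmod (cis (- (\<eta> * t)) - 1))\<^sup>2 * (cmod (f t))\<^sup>2"
      by (simp only: norm_mult power_mult_distrib)
  qed
  finally show ?thesis .
qed

lemma nn_integral_ft_product_translate_le: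
  assumes f: "integrable lborel f" and c: "c \<noteq> 0" and \<delta>: "\<delta> > 0"
  shows "(\<integral>\<^sup>+ u. ennreal (cmod (ft f (u * c / 2 + \<eta>) * cnj (ft f (- (u * c / 2) + \<eta>))
            - ft f (u * c / 2) * cnj (ft f (- (u * c / 2))))) \<partial>lborel)
    \<le> ennreal (4 * pi / \<bar>c\<bar>) * (ennreal \<delta> * l2sq f + ennreal (1 / \<delta>) *
        (\<integral>\<^sup>+ t. ennreal ((cmod (cis (- (\<eta> * t)) - 1))\<^sup>2 * (cmod (f t))\<^sup>2) \<partial>lborel))"
proof -
  have [measurable]: "f \<in> borel_measurable borel" using f by auto
  let ?D = "\<lambda>\<xi>. ft f (\<eta> + \<xi>) - ft f \<xi>"
  let ?T = "\<integral>\<^sup>+ t. ennreal ((cmod (cis (- (\<eta> * t)) - 1))\<^sup>2 * (cmod (f t))\<^sup>2) \<partial>lborel"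
  have A: "l2sq (\<lambda>u. F (s * (c / 2) * u)) = ennreal (2 / \<bar>c\<bar>) * l2sq F"
    if "F \<in> borel_measurable borel" "s = 1 \<or> s = -1" for F s
    using l2sq_affine[OF that(1), of "s * (c / 2)" 0] that(2) c by auto
  have A': "l2sq (\<lambda>u. F (\<eta> + s * (c / 2) * u)) = ennreal (2 / \<bar>c\<bar>) * l2sq F"
    if "F \<in> borel_measurable borel" "s = 1 \<or> s = -1" for F s
    using l2sq_affine[OF that(1), of "s * (c / 2)" \<eta>] that(2) c by auto
  have "ft f \<in> borel_measurable borel" "?D \<in> borel_measurable borel" by measurable
  note m = this
  note sc = A'[OF m(1) disjI2[OF refl]] A[OF m(1) disjI1[OF refl]]
    A[OF m(2) disjI1[OF refl]] A[OF m(2) disjI2[OF refl]]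
  have "(\<integral>\<^sup>+ u. ennreal (cmod (ft f (u * c / 2 + \<eta>) * cnj (ft f (- (u * c / 2) + \<eta>))
            - ft f (u * c / 2) * cnj (ft f (- (u * c / 2))))) \<partial>lborel)
     = (\<integral>\<^sup>+ u. ennreal (cmod (ft f (\<eta> + 1 * (c / 2) * u) * cnj (ft f (\<eta> + (-1) * (c / 2) * u))
            - ft f (1 * (c / 2) * u) * cnj (ft f ((-1) * (c / 2) * u)))) \<partial>lborel)"
    by (simp add: algebra_simps)
  also have "\<dots> \<le> ennreal (\<delta> / 2) * (l2sq (\<lambda>u. ft f (\<eta> + (-1) * (c / 2) * u)) + l2sq (\<lambda>u. ft f (1 * (c / 2) * u)))
      + ennreal (1 / (2 * \<delta>)) * (l2sq (\<lambda>u. ?D (1 * (c / 2) * u)) + l2sq (\<lambda>u. ?D ((-1) * (c / 2) * u)))"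
    by (rule nn_integral_product_diff_le[OF \<delta>]) measurable
  also have "\<dots> = ennreal (\<delta> / 2) * (ennreal (2 / \<bar>c\<bar>) * l2sq (ft f) + ennreal (2 / \<bar>c\<bar>) * l2sq (ft f))
      + ennreal (1 / (2 * \<delta>)) * (ennreal (2 / \<bar>c\<bar>) * l2sq ?D + ennreal (2 / \<bar>c\<bar>) * l2sq ?D)"
    unfolding sc ..
  also have "\<dots> \<le> ennreal (\<delta> / 2) * (ennreal (2 / \<bar>c\<bar>) * (ennreal (2 * pi) * l2sq f) + ennreal (2 / \<bar>c\<bar>) * (ennreal (2 * pi) * l2sq f))
      + ennreal (1 / (2 * \<delta>)) * (ennreal (2 / \<bar>c\<bar>) * (ennreal (2 * pi) * ?T) + ennreal (2 / \<bar>c\<bar>) * (ennreal (2 * pi) * ?T))"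
    by (intro add_mono mult_left_mono l2sq_ft_le[OF f] l2sq_ft_translate_le[OF f]) simp_all
  also have "\<dots> = ennreal (4 * pi / \<bar>c\<bar>) * (ennreal \<delta> * l2sq f + ennreal (1 / \<delta>) * ?T)"
  proof -
    have "ennreal d * (ennreal (2 / \<bar>c\<bar>) * (ennreal (2 * pi) * X) + ennreal (2 / \<bar>c\<bar>) * (ennreal (2 * pi) * X))
       = ennreal (4 * pi / \<bar>c\<bar>) * (ennreal (2 * d) * X)" if "d \<ge> 0" for d X
    proof -
      have "d * (2 / \<bar>c\<bar>) * (2 * pi) + d * (2 / \<bar>c\<bar>) * (2 * pi) = 4 * pi / \<bar>c\<bar> * (2 * d)" by simp
      then have "ennreal d * ennreal (2 / \<bar>c\<bar>) * ennreal (2 * pi) + ennreal d * ennreal (2 / \<bar>c\<bar>) * ennreal (2 * pi)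
          = ennreal (4 * pi / \<bar>c\<bar>) * ennreal (2 * d)"
        using that by (simp flip: ennreal_mult ennreal_plus)
      then have "(ennreal d * ennreal (2 / \<bar>c\<bar>) * ennreal (2 * pi) + ennreal d * ennreal (2 / \<bar>c\<bar>) * ennreal (2 * pi)) * X
          = ennreal (4 * pi / \<bar>c\<bar>) * ennreal (2 * d) * X" by simp
      then show ?thesis by (simp only: distrib_left distrib_right mult.assoc)
    qed
    from this[of "\<delta> / 2"] this[of "1 / (2 * \<delta>)"] show ?thesis
      using \<delta> by (simp add: distrib_left)
  qed
  finally show ?thesis .
qed

text \<open>Gaussian averages of the product of two opposite values of \<open>ft f\<close> approximate the product itself
  in \<open>L\<^sup>1(du)\<close>.\<close>

lemma nn_integral_gaussian_average_ft_le:
  assumes f: "integrable lborel f" and c: "c \<noteq> 0" and \<delta>: "\<delta> > 0" and \<sigma>: "\<sigma> > 0"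
  shows "(\<integral>\<^sup>+ u. ennreal (cmod ((LBINT \<eta>. of_real (normal_density 0 \<sigma> \<eta>)
              * (ft f (u * c / 2 + \<eta>) * cnj (ft f (- (u * c / 2) + \<eta>))))
            - ft f (u * c / 2) * cnj (ft f (- (u * c / 2))))) \<partial>lborel)
    \<le> ennreal (4 * pi / \<bar>c\<bar>) * (ennreal \<delta> * l2sq f + ennreal (1 / \<delta>) * osc \<sigma> f)"
proof -
  have [measurable]: "f \<in> borel_measurable borel" using f by auto
  define N where "N = normal_density 0 \<sigma>"
  have [measurable]: "N \<in> borel_measurable borel" by (simp add: N_def)
  have N0: "N \<eta> \<ge> 0" for \<eta> by (simp add: N_def)
  have Ni: "integrable lborel N" "(LBINT \<eta>. N \<eta>) = 1" using \<sigma> by (simp_all add: N_def)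
  have Nn: "(\<integral>\<^sup>+ \<eta>. ennreal (N \<eta>) \<partial>lborel) = 1"
    using Ni N0 by (subst nn_integral_eq_integral) auto
  define X where "X = (\<lambda>u \<eta>. ft f (u * c / 2 + \<eta>) * cnj (ft f (- (u * c / 2) + \<eta>)))"
  have [measurable]: "(\<lambda>z. X (fst z) (snd z)) \<in> borel_measurable (borel \<Otimes>\<^sub>M borel)"
    unfolding X_def by measurable
  have [measurable]: "X u \<in> borel_measurable borel" for u
    unfolding X_def by measurable
  have Xi: "integrable lborel (\<lambda>\<eta>. of_real (N \<eta>) * X u \<eta>)" for u
  proof (rule Bochner_Integration.integrable_bound)
    show "integrable lborel (\<lambda>\<eta>. N \<eta> * ((LBINT t. cmod (f t)) * (LBINT t. cmod (f t))))"
      by (intro integrable_mult_left Ni)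
    show "AE \<eta> in lborel. norm (of_real (N \<eta>) * X u \<eta>) \<le> norm (N \<eta> * ((LBINT t. cmod (f t)) * (LBINT t. cmod (f t))))"
      by (auto simp: X_def norm_mult N0 abs_mult intro!: mult_left_mono mult_mono norm_ft_le order_trans[OF norm_ft_le])
  qed measurable
  have step: "ennreal (cmod ((LBINT \<eta>. of_real (N \<eta>) * X u \<eta>) - X u 0))
     \<le> (\<integral>\<^sup>+ \<eta>. ennreal (N \<eta>) * ennreal (cmod (X u \<eta> - X u 0)) \<partial>lborel)" for u
  proof -
    have i0: "integrable lborel (\<lambda>\<eta>. complex_of_real (N \<eta>) * X u 0)"
      by (intro integrable_mult_left integrable_of_real Ni)
    have "X u 0 = (LBINT \<eta>. complex_of_real (N \<eta>) * X u 0)"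
      using Ni by simp
    then have "(LBINT \<eta>. of_real (N \<eta>) * X u \<eta>) - X u 0
        = (LBINT \<eta>. of_real (N \<eta>) * X u \<eta> - of_real (N \<eta>) * X u 0)"
      using Bochner_Integration.integral_diff[OF Xi[of u] i0] by simp
    also have "ennreal (cmod \<dots>) \<le> (\<integral>\<^sup>+ \<eta>. ennreal (cmod (of_real (N \<eta>) * X u \<eta> - of_real (N \<eta>) * X u 0)) \<partial>lborel)"
      by (intro integral_norm_bound_ennreal Bochner_Integration.integrable_diff Xi i0)
    also have "\<dots> = (\<integral>\<^sup>+ \<eta>. ennreal (N \<eta>) * ennreal (cmod (X u \<eta> - X u 0)) \<partial>lborel)"
      by (simp add: norm_mult N0 ennreal_mult flip: right_diff_distrib)
    finally show ?thesis .
  qed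
  let ?T = "\<lambda>\<eta>. \<integral>\<^sup>+ t. ennreal ((cmod (cis (- (\<eta> * t)) - 1))\<^sup>2 * (cmod (f t))\<^sup>2) \<partial>lborel"
  have "(\<integral>\<^sup>+ u. ennreal (cmod ((LBINT \<eta>. of_real (N \<eta>) * X u \<eta>) - X u 0)) \<partial>lborel)
      \<le> (\<integral>\<^sup>+ u. \<integral>\<^sup>+ \<eta>. ennreal (N \<eta>) * ennreal (cmod (X u \<eta> - X u 0)) \<partial>lborel \<partial>lborel)"
    by (intro nn_integral_mono step)
  also have "\<dots> = (\<integral>\<^sup>+ \<eta>. \<integral>\<^sup>+ u. ennreal (N \<eta>) * ennreal (cmod (X u \<eta> - X u 0)) \<partial>lborel \<partial>lborel)"
    unfolding X_def by (rule lborel_pair.Fubini'[symmetric]) measurable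
  also have "\<dots> = (\<integral>\<^sup>+ \<eta>. ennreal (N \<eta>) * (\<integral>\<^sup>+ u. ennreal (cmod (X u \<eta> - X u 0)) \<partial>lborel) \<partial>lborel)"
    unfolding X_def by (intro nn_integral_cong nn_integral_cmult) measurable
  also have "\<dots> \<le> (\<integral>\<^sup>+ \<eta>. ennreal (N \<eta>) * (ennreal (4 * pi / \<bar>c\<bar>) * (ennreal \<delta> * l2sq f + ennreal (1 / \<delta>) * ?T \<eta>)) \<partial>lborel)"
    unfolding X_def using nn_integral_ft_product_translate_le[OF f c \<delta>]
    by (intro nn_integral_mono mult_left_mono) simp_all
  also have "\<dots> = (\<integral>\<^sup>+ \<eta>. ennreal (4 * pi / \<bar>c\<bar>) * (ennreal \<delta> * l2sq f * ennreal (N \<eta>) + ennreal (1 / \<delta>) * (ennreal (N \<eta>) * ?T \<eta>)) \<partial>lborel)"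
    by (intro nn_integral_cong) (simp only: distrib_left mult_ac)
  also have "\<dots> = ennreal (4 * pi / \<bar>c\<bar>) * (ennreal \<delta> * l2sq f + ennreal (1 / \<delta>) * (\<integral>\<^sup>+ \<eta>. ennreal (N \<eta>) * ?T \<eta> \<partial>lborel))"
    by (simp add: nn_integral_add nn_integral_cmult Nn)
  also have "(\<integral>\<^sup>+ \<eta>. ennreal (N \<eta>) * ?T \<eta> \<partial>lborel)
      = (\<integral>\<^sup>+ \<eta>. \<integral>\<^sup>+ t. ennreal (N \<eta>) * ennreal ((cmod (cis (- (\<eta> * t)) - 1))\<^sup>2 * (cmod (f t))\<^sup>2) \<partial>lborel \<partial>lborel)"
    by (simp add: nn_integral_cmult)
  also have "\<dots> = (\<integral>\<^sup>+ t. \<integral>\<^sup>+ \<eta>. ennreal (N \<eta>) * ennreal ((cmod (cis (- (\<eta> * t)) - 1))\<^sup>2 * (cmod (f t))\<^sup>2) \<partial>lborel \<partial>lborel)"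
    by (rule lborel_pair.Fubini'[symmetric]) measurable
  also have "\<dots> = osc \<sigma> f"
    unfolding osc_def
  proof (intro nn_integral_cong)
    fix t
    have "(\<integral>\<^sup>+ \<eta>. ennreal (N \<eta>) * ennreal ((cmod (cis (- (\<eta> * t)) - 1))\<^sup>2 * (cmod (f t))\<^sup>2) \<partial>lborel)
       = (\<integral>\<^sup>+ \<eta>. ennreal (N \<eta> * (cmod (cis (- (\<eta> * t)) - 1))\<^sup>2) * ennreal ((cmod (f t))\<^sup>2) \<partial>lborel)"
      by (simp add: ennreal_mult N0 mult.assoc)
    also have "\<dots> = ennreal (2 - 2 * exp (- (\<sigma>\<^sup>2 * t\<^sup>2 / 2))) * ennreal ((cmod (f t))\<^sup>2)"
      by (subst nn_integral_multc) (simp_all add: N_def nn_integral_normal_density_cis_minus_1[OF \<sigma>])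
    also have "\<dots> = ennreal ((2 - 2 * exp (- (\<sigma>\<^sup>2 * t\<^sup>2 / 2))) * (cmod (f t))\<^sup>2)"
      by (simp add: ennreal_mult)
    finally show "(\<integral>\<^sup>+ \<eta>. ennreal (N \<eta>) * ennreal ((cmod (cis (- (\<eta> * t)) - 1))\<^sup>2 * (cmod (f t))\<^sup>2) \<partial>lborel) = \<dots>" .
  qed
  finally show ?thesis by (simp add: X_def N_def)
qed

lemma nn_integral_amb_damped_marginal_le:
  assumes y: "integrable lborel y" and a: "a > 0" and \<epsilon>: "\<epsilon> > 0" and c: "c \<noteq> 0" and \<delta>: "\<delta> > 0"
  shows "(\<integral>\<^sup>+ u. ennreal (cmod ((LBINT \<tau>. of_real (exp (- \<epsilon> * \<tau>\<^sup>2)) * amb a y \<tau> (u * c))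
            - of_real (1 / (2 * a)) * (ft y (u * c / 2) * cnj (ft y (- (u * c / 2)))))) \<partial>lborel)
    \<le> ennreal (2 * pi / (a * \<bar>c\<bar>)) * (ennreal \<delta> * l2sq y + ennreal (1 / \<delta>) * osc (sqrt (2 * \<epsilon>) / (2 * a)) y)"
proof -
  have [measurable]: "y \<in> borel_measurable borel" using y by auto
  have \<sigma>: "sqrt (2 * \<epsilon>) / (2 * a) > 0" using a \<epsilon> by simp
  have r: "cmod (of_real (1 / (2 * a))) = 1 / (2 * a)"
    unfolding norm_of_real using a by simp
  let ?Z = "\<lambda>u. (LBINT \<eta>. of_real (normal_density 0 (sqrt (2 * \<epsilon>) / (2 * a)) \<eta>)
              * (ft y (u * c / 2 + \<eta>) * cnj (ft y (- (u * c / 2) + \<eta>))))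
            - ft y (u * c / 2) * cnj (ft y (- (u * c / 2)))"
  have "(\<integral>\<^sup>+ u. ennreal (cmod ((LBINT \<tau>. of_real (exp (- \<epsilon> * \<tau>\<^sup>2)) * amb a y \<tau> (u * c))
            - of_real (1 / (2 * a)) * (ft y (u * c / 2) * cnj (ft y (- (u * c / 2)))))) \<partial>lborel)
     = (\<integral>\<^sup>+ u. ennreal (1 / (2 * a)) * ennreal (cmod (?Z u)) \<partial>lborel)"
    unfolding amb_damped_marginal_ft[OF y a \<epsilon>] right_diff_distrib[symmetric] norm_mult r
    using a by (intro nn_integral_cong ennreal_mult') simp
  also have "\<dots> = ennreal (1 / (2 * a)) * (\<integral>\<^sup>+ u. ennreal (cmod (?Z u)) \<partial>lborel)"
    by (rule nn_integral_cmult) measurable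
  also have "\<dots> \<le> ennreal (1 / (2 * a)) * (ennreal (4 * pi / \<bar>c\<bar>) * (ennreal \<delta> * l2sq y + ennreal (1 / \<delta>) * osc (sqrt (2 * \<epsilon>) / (2 * a)) y))"
    by (intro mult_left_mono nn_integral_gaussian_average_ft_le y c \<delta> \<sigma>) simp
  also have "\<dots> = ennreal (1 / (2 * a) * (4 * pi / \<bar>c\<bar>)) * (ennreal \<delta> * l2sq y + ennreal (1 / \<delta>) * osc (sqrt (2 * \<epsilon>) / (2 * a)) y)"
  proof -
    have "0 \<le> 1 / (2 * a)" "0 \<le> 4 * pi / \<bar>c\<bar>" using a by simp_all
    then show ?thesis by (simp only: ennreal_mult mult.assoc)
  qed
  also have "1 / (2 * a) * (4 * pi / \<bar>c\<bar>) = 2 * pi / (a * \<bar>c\<bar>)" by simp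
  finally show ?thesis .
qed

section \<open>The fractional Fourier transform as a mean limit\<close>

lemma l2sq_cong_norm: "(\<And>t. cmod (f t) = cmod (g t)) \<Longrightarrow> l2sq f = l2sq g"
  by (simp add: l2sq_def)

lemma l2sq_mono: "(\<And>t. cmod (f t) \<le> cmod (g t)) \<Longrightarrow> l2sq f \<le> l2sq g"
  unfolding l2sq_def by (intro nn_integral_mono ennreal_leI power_mono) auto

lemma l2sq_add_le:
  assumes [measurable]: "f \<in> borel_measurable borel" "g \<in> borel_measurable borel"
  shows "l2sq (\<lambda>t. f t + g t) \<le> 2 * l2sq f + 2 * l2sq g"
proof -
  have "ennreal ((cmod (f t + g t))\<^sup>2) \<le> 2 * ennreal ((cmod (f t))\<^sup>2) + 2 * ennreal ((cmod (g t))\<^sup>2)" for t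
  proof -
    have "(cmod (f t + g t))\<^sup>2 \<le> (cmod (f t) + cmod (g t))\<^sup>2"
      by (intro power_mono norm_triangle_ineq) simp
    also have "\<dots> \<le> 2 * (cmod (f t))\<^sup>2 + 2 * (cmod (g t))\<^sup>2"
      using sum_squares_bound[of "cmod (f t)" "cmod (g t)"] by (simp add: power2_sum)
    finally have "ennreal ((cmod (f t + g t))\<^sup>2) \<le> ennreal (2 * (cmod (f t))\<^sup>2 + 2 * (cmod (g t))\<^sup>2)"
      by (rule ennreal_leI)
    then show ?thesis by (simp add: ennreal_mult)
  qed
  then have "l2sq (\<lambda>t. f t + g t)
     \<le> (\<integral>\<^sup>+ t. 2 * ennreal ((cmod (f t))\<^sup>2) + 2 * ennreal ((cmod (g t))\<^sup>2) \<partial>lborel)"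
    unfolding l2sq_def by (intro nn_integral_mono) auto
  also have "\<dots> = 2 * l2sq f + 2 * l2sq g"
    unfolding l2sq_def by (simp add: nn_integral_add nn_integral_cmult)
  finally show ?thesis .
qed

lemma l2sq_diff_commute: "l2sq (\<lambda>t. f t - g t) = l2sq (\<lambda>t. g t - f t)"
  by (rule l2sq_cong_norm) (simp add: norm_minus_commute)

lemma square_integrable_iff:
  "square_integrable x \<longleftrightarrow> x \<in> borel_measurable borel \<and> l2sq x < \<infinity>"
  unfolding square_integrable_def l2sq_def
  by (auto simp: integrable_iff_bounded)

text \<open>Multiplication by the quadratic phase that reduces the fractional transform of order \<open>\<theta>\<close> to the
  ordinary Fourier transform.\<close>

definition chirp :: "real \<Rightarrow> (real \<Rightarrow> complex) \<Rightarrow> real \<Rightarrow> complex" where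
  "chirp \<theta> x t = x t * cis (t\<^sup>2 * cot \<theta> / 2)"

lemma norm_chirp [simp]: "cmod (chirp \<theta> x t) = cmod (x t)"
  by (simp add: chirp_def norm_mult)

lemma measurable_chirp [measurable]:
  assumes [measurable]: "x \<in> borel_measurable borel"
  shows "chirp \<theta> x \<in> borel_measurable borel"
  unfolding chirp_def[abs_def] by measurable

lemma integrable_chirp: "integrable lborel x \<Longrightarrow> integrable lborel (chirp \<theta> x)"
  unfolding chirp_def[abs_def] by (rule integrable_mult_cis) auto

lemma l2sq_chirp [simp]: "l2sq (chirp \<theta> x) = l2sq x"
  by (rule l2sq_cong_norm) simp

lemma osc_chirp [simp]: "osc \<sigma> (chirp \<theta> x) = osc \<sigma> x"
  by (simp add: osc_def)

lemma nfraf_eq_amb: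
  "nfraf \<theta> k x \<tau> u = of_real ((cmod (Omega \<theta>))\<^sup>2) * amb (k / 2) (chirp \<theta> x) \<tau> (u * csc \<theta>)"
proof -
  have "x (t + k * \<tau> / 2) * cnj (x (t - k * \<tau> / 2)) * exp (\<i> * of_real (t * (k * \<tau> * cot \<theta> - u * csc \<theta>)))
    = chirp \<theta> x (t + k / 2 * \<tau>) * cnj (chirp \<theta> x (t - k / 2 * \<tau>)) * cis (- (u * csc \<theta> * t))" for t
  proof -
    define p where "p = t + k * \<tau> / 2"
    define q where "q = t - k * \<tau> / 2"
    \<comment> \<open>The cross term of the NFrAF comes from \<open>p\<^sup>2 - q\<^sup>2 = 2 * k * \<tau> * t\<close>.\<close>
    have pq: "t * (k * \<tau> * cot \<theta> - u * csc \<theta>) = p\<^sup>2 * cot \<theta> / 2 + (- (q\<^sup>2 * cot \<theta> / 2)) + (- (u * csc \<theta> * t))"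
      by (simp add: p_def q_def power2_eq_square field_simps)
    have "t + k / 2 * \<tau> = p" "t - k / 2 * \<tau> = q" by (simp_all add: p_def q_def)
    then show ?thesis
      unfolding p_def[symmetric] q_def[symmetric] cis_conv_exp[symmetric] pq cis_mult[symmetric]
      by (simp add: chirp_def cis_cnj mult_ac)
  qed
  then show ?thesis by (simp add: nfraf_def amb_def)
qed

text \<open>The integral defining the fractional Fourier transform, for every \<open>x\<close>; it agrees with \<open>frft\<close> when
  \<open>x\<close> is integrable and is 0 otherwise.\<close>

definition frft_int :: "real \<Rightarrow> (real \<Rightarrow> complex) \<Rightarrow> real \<Rightarrow> complex" where
  "frft_int \<theta> x u = (LBINT t. x t * frft_kernel \<theta> t u)"

lemma frft_int_eq_ft:
  "frft_int \<theta> x u = Omega \<theta> * cis (u\<^sup>2 * cot \<theta> / 2) * ft (chirp \<theta> x) (csc \<theta> * u)"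
proof -
  have "frft_kernel \<theta> t u = Omega \<theta> * cis (u\<^sup>2 * cot \<theta> / 2) * (cis (t\<^sup>2 * cot \<theta> / 2) * cis (- (csc \<theta> * u * t)))" for t
  proof -
    have "\<i> / 2 * of_real ((t\<^sup>2 + u\<^sup>2) * cot \<theta>) - \<i> * of_real (u * t * csc \<theta>)
       = \<i> * of_real (u\<^sup>2 * cot \<theta> / 2 + (t\<^sup>2 * cot \<theta> / 2 + (- (csc \<theta> * u * t))))"
      by (simp add: field_simps)
    then show ?thesis
      unfolding frft_kernel_def by (simp only: cis_conv_exp[symmetric] cis_mult mult.assoc)
  qed
  then have "frft_int \<theta> x u
      = (LBINT t. Omega \<theta> * cis (u\<^sup>2 * cot \<theta> / 2) * (chirp \<theta> x t * cis (- (csc \<theta> * u * t))))"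
    unfolding frft_int_def chirp_def by (intro Bochner_Integration.integral_cong) (auto simp: mult_ac)
  then show ?thesis unfolding ft_def by simp
qed

lemma measurable_frft_int [measurable]:
  assumes [measurable]: "x \<in> borel_measurable borel"
  shows "frft_int \<theta> x \<in> borel_measurable borel"
  unfolding frft_int_eq_ft[abs_def] by measurable

lemma frft_int_diff:
  assumes x: "integrable lborel x" and z: "integrable lborel z"
  shows "frft_int \<theta> (\<lambda>t. x t - z t) u = frft_int \<theta> x u - frft_int \<theta> z u"
proof -
  have "chirp \<theta> (\<lambda>t. x t - z t) = (\<lambda>t. chirp \<theta> x t - chirp \<theta> z t)"
    by (simp add: chirp_def fun_eq_iff left_diff_distrib)
  then show ?thesis
    unfolding frft_int_eq_ft by (simp add: ft_diff integrable_chirp x z right_diff_distrib)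
qed

lemma frft_int_product:
  "frft_int \<theta> x (u / 2) * cnj (frft_int \<theta> x (- u / 2)) = of_real ((cmod (Omega \<theta>))\<^sup>2) *
     (ft (chirp \<theta> x) (u * csc \<theta> / 2) * cnj (ft (chirp \<theta> x) (- (u * csc \<theta> / 2))))"
proof -
  have "cis ((u / 2)\<^sup>2 * cot \<theta> / 2) * cnj (cis ((- u / 2)\<^sup>2 * cot \<theta> / 2)) = 1"
    by (simp add: cis_cnj cis_mult)
  moreover have "(w * e * P) * cnj (w * e' * Q) = (w * cnj w) * (P * cnj Q)"
    if "e * cnj e' = 1" for w e e' P Q :: complex
  proof -
    have "(w * e * P) * cnj (w * e' * Q) = (w * cnj w) * (P * cnj Q) * (e * cnj e')"
      by (simp add: mult_ac)
    then show ?thesis using that by simp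
  qed
  ultimately have "frft_int \<theta> x (u / 2) * cnj (frft_int \<theta> x (- u / 2)) = (Omega \<theta> * cnj (Omega \<theta>)) *
     (ft (chirp \<theta> x) (csc \<theta> * (u / 2)) * cnj (ft (chirp \<theta> x) (csc \<theta> * (- u / 2))))"
    unfolding frft_int_eq_ft by blast
  moreover have "csc \<theta> * (u / 2) = u * csc \<theta> / 2" "csc \<theta> * (- u / 2) = - (u * csc \<theta> / 2)"
    by simp_all
  ultimately show ?thesis by (simp only: complex_norm_square)
qed

text \<open>The bound for the squared \<open>L\<^sup>2\<close> norm given by the Plancherel inequality.  Its exact value, 1 for
  \<open>\<theta>\<close> outside \<open>\<pi> \<int>\<close>, is not needed.\<close>

definition frft_const :: "real \<Rightarrow> real" where
  "frft_const \<theta> = (cmod (Omega \<theta>))\<^sup>2 * (1 / \<bar>csc \<theta>\<bar>) * (2 * pi)"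

lemma frft_const_nonneg: "frft_const \<theta> \<ge> 0"
  by (simp add: frft_const_def)

lemma l2sq_frft_int_le:
  assumes x: "integrable lborel x" and c: "csc \<theta> \<noteq> 0"
  shows "l2sq (frft_int \<theta> x) \<le> ennreal (frft_const \<theta>) * l2sq x"
proof -
  have [measurable]: "x \<in> borel_measurable borel" using x by auto
  have "l2sq (frft_int \<theta> x) = (\<integral>\<^sup>+ u. ennreal ((cmod (Omega \<theta>))\<^sup>2) * ennreal ((cmod (ft (chirp \<theta> x) (0 + csc \<theta> * u)))\<^sup>2) \<partial>lborel)"
    unfolding l2sq_def by (simp add: frft_int_eq_ft norm_mult power_mult_distrib ennreal_mult)
  also have "\<dots> = ennreal ((cmod (Omega \<theta>))\<^sup>2) * l2sq (\<lambda>u. ft (chirp \<theta> x) (0 + csc \<theta> * u))"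
    unfolding l2sq_def by (rule nn_integral_cmult) measurable
  also have "l2sq (\<lambda>u. ft (chirp \<theta> x) (0 + csc \<theta> * u)) = ennreal (1 / \<bar>csc \<theta>\<bar>) * l2sq (ft (chirp \<theta> x))"
    by (rule l2sq_affine[OF _ c]) measurable
  also have "ennreal ((cmod (Omega \<theta>))\<^sup>2) * (ennreal (1 / \<bar>csc \<theta>\<bar>) * l2sq (ft (chirp \<theta> x)))
      \<le> ennreal ((cmod (Omega \<theta>))\<^sup>2) * (ennreal (1 / \<bar>csc \<theta>\<bar>) * (ennreal (2 * pi) * l2sq x))"
    using l2sq_ft_le[OF integrable_chirp[OF x]] by (intro mult_left_mono) simp_all
  also have "\<dots> = ennreal (frft_const \<theta>) * l2sq x"
  proof -
    have "0 \<le> (cmod (Omega \<theta>))\<^sup>2" "0 \<le> 1 / \<bar>csc \<theta>\<bar>" "0 \<le> 2 * pi" by simp_all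
    then show ?thesis
      unfolding frft_const_def by (simp only: ennreal_mult mult_nonneg_nonneg mult.assoc)
  qed
  finally show ?thesis .
qed

text \<open>The signal cut off outside \<open>[-R, R]\<close>.\<close>

definition trunc :: "real \<Rightarrow> (real \<Rightarrow> complex) \<Rightarrow> real \<Rightarrow> complex" where
  "trunc R x t = indicator {-R..R} t *\<^sub>R x t"

lemma measurable_trunc [measurable]:
  assumes [measurable]: "x \<in> borel_measurable borel"
  shows "trunc R x \<in> borel_measurable borel"
  unfolding trunc_def[abs_def] by measurable

lemma norm_trunc_le: "cmod (trunc R x t) \<le> cmod (x t)"
  by (simp add: trunc_def indicator_def)

lemma frft_int_trunc: "frft_int \<theta> (trunc R x) u = (LBINT t:{-R..R}. x t * frft_kernel \<theta> t u)"
  unfolding frft_int_def set_lebesgue_integral_def trunc_def by simp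

lemma integrable_trunc:
  assumes "square_integrable x"
  shows "integrable lborel (trunc R x)"
proof (rule Bochner_Integration.integrable_bound)
  have [measurable]: "x \<in> borel_measurable borel" using assms by (simp add: square_integrable_iff)
  show "integrable lborel (\<lambda>t. indicator {-R..R} t + (cmod (x t))\<^sup>2)"
    using assms by (intro Bochner_Integration.integrable_add integrable_real_indicator)
      (auto simp: square_integrable_def emeasure_lborel_Icc_eq)
  show "trunc R x \<in> borel_measurable lborel" by measurable
  have "cmod (x t) \<le> 1 + (cmod (x t))\<^sup>2" for t
  proof -
    have "2 * cmod (x t) \<le> 1 + (cmod (x t))\<^sup>2"
      using sum_squares_bound[of "cmod (x t)" 1] by simp
    then show ?thesis using norm_ge_zero[of "x t"] by linarith
  qed
  then show "AE t in lborel. norm (trunc R x t) \<le> norm (indicator {-R..R} t + (cmod (x t))\<^sup>2)"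
    by (auto simp: trunc_def indicator_def)
qed

lemma trunc_tendsto: "((\<lambda>R. trunc R x t) \<longlongrightarrow> x t) at_top"
proof (rule tendsto_eventually)
  have "trunc R x t = x t" if "R \<ge> \<bar>t\<bar>" for R
    using that by (auto simp: trunc_def indicator_def)
  then show "\<forall>\<^sub>F R in at_top. trunc R x t = x t"
    using eventually_ge_at_top by (rule eventually_mono[rotated])
qed

lemma l2sq_trunc_tendsto:
  assumes x: "square_integrable x"
  shows "((\<lambda>R. l2sq (\<lambda>t. x t - trunc R x t)) \<longlongrightarrow> 0) at_top"
proof -
  have [measurable]: "x \<in> borel_measurable borel" using x by (simp add: square_integrable_iff)
  have i: "integrable lborel (\<lambda>t. (cmod (x t))\<^sup>2)" using x by (simp add: square_integrable_def)
  have b: "cmod (x t - trunc R x t) \<le> cmod (x t)" for R t by (simp add: trunc_def indicator_def)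
  have i': "integrable lborel (\<lambda>t. (cmod (x t - trunc R x t))\<^sup>2)" for R
    by (rule Bochner_Integration.integrable_bound[OF i]) (auto intro!: power_mono b)
  have "((\<lambda>R. LBINT t. (cmod (x t - trunc R x t))\<^sup>2) \<longlongrightarrow> (LBINT t::real. 0)) at_top"
  proof (rule integral_dominated_convergence_at_top[OF _ _ i])
    show "AE t in lborel. ((\<lambda>R. (cmod (x t - trunc R x t))\<^sup>2) \<longlongrightarrow> 0) at_top"
    proof (rule AE_I2)
      fix t
      have "((\<lambda>R. (cmod (x t - trunc R x t))\<^sup>2) \<longlongrightarrow> (cmod (x t - x t))\<^sup>2) at_top"
        by (intro tendsto_intros trunc_tendsto)
      then show "((\<lambda>R. (cmod (x t - trunc R x t))\<^sup>2) \<longlongrightarrow> 0) at_top" by simp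
    qed
    show "\<forall>\<^sub>F R in at_top. AE t in lborel. norm ((cmod (x t - trunc R x t))\<^sup>2) \<le> (cmod (x t))\<^sup>2"
      by (intro always_eventually allI AE_I2) (auto intro!: power_mono b)
  qed measurable
  then have "((\<lambda>R. ennreal (LBINT t. (cmod (x t - trunc R x t))\<^sup>2)) \<longlongrightarrow> ennreal 0) at_top"
    by (intro tendsto_ennrealI) simp
  moreover have "l2sq (\<lambda>t. x t - trunc R x t) = ennreal (LBINT t. (cmod (x t - trunc R x t))\<^sup>2)" for R
    unfolding l2sq_def by (rule nn_integral_eq_integral[OF i']) simp
  ultimately show ?thesis by simp
qed

text \<open>The core of the Riesz-Fischer theorem: a fast Cauchy sequence in \<open>L\<^sup>2\<close> converges almost everywhere,
  since \<open>\<Sum>j. 2 ^ j * \<bar>F (Suc j) - F j\<bar>\<^sup>2\<close> has finite integral.\<close>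

lemma l2_cauchy_AE_convergent:
  assumes [measurable]: "\<And>j. F j \<in> borel_measurable borel"
    and small: "\<And>j. l2sq (\<lambda>u. F (Suc j) u - F j u) \<le> ennreal ((1/4) ^ j)"
  shows "\<exists>G \<in> borel_measurable borel. AE u in lborel. (\<lambda>j. F j u) \<longlonglongrightarrow> G u"
proof -
  define d where "d = (\<lambda>j u. F (Suc j) u - F j u)"
  have [measurable]: "d j \<in> borel_measurable borel" for j unfolding d_def by measurable
  define g where "g = (\<lambda>u. \<Sum>j. ennreal (2 ^ j * (cmod (d j u))\<^sup>2))"
  have [measurable]: "g \<in> borel_measurable borel" unfolding g_def by measurable
  have "(\<integral>\<^sup>+ u. g u \<partial>lborel) = (\<Sum>j. \<integral>\<^sup>+ u. ennreal (2 ^ j * (cmod (d j u))\<^sup>2) \<partial>lborel)"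
    unfolding g_def by (rule nn_integral_suminf) measurable
  also have "\<dots> = (\<Sum>j. ennreal (2 ^ j) * l2sq (d j))"
    unfolding l2sq_def by (simp add: ennreal_mult nn_integral_cmult)
  also have "\<dots> \<le> (\<Sum>j. ennreal ((1/2) ^ j))"
  proof (rule suminf_le)
    fix j
    have "ennreal (2 ^ j) * l2sq (d j) \<le> ennreal (2 ^ j) * ennreal ((1/4) ^ j)"
      using small[of j] unfolding d_def by (intro mult_left_mono) simp_all
    also have "\<dots> = ennreal ((1/2) ^ j)"
      by (subst ennreal_mult[symmetric]) (simp_all flip: power_mult_distrib)
    finally show "ennreal (2 ^ j) * l2sq (d j) \<le> ennreal ((1/2) ^ j)" .
  qed simp_all
  also have "\<dots> = ennreal (\<Sum>j. (1/2) ^ j)"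
    by (rule suminf_ennreal2) (simp_all add: summable_geometric)
  also have "\<dots> < \<infinity>" by simp
  finally have "(\<integral>\<^sup>+ u. g u \<partial>lborel) \<noteq> \<infinity>" by simp
  then have "AE u in lborel. g u \<noteq> \<infinity>" by (intro nn_integral_PInf_AE) measurable
  then have "AE u in lborel. (\<lambda>j. F j u) \<longlonglongrightarrow> lim (\<lambda>j. F j u)"
  proof eventually_elim
    case (elim u)
    then obtain C where C: "g u = ennreal C" "C \<ge> 0" by (cases "g u") auto
    define r where "r = sqrt (1/2)"
    have r: "0 \<le> r" "r < 1" by (simp_all add: r_def)
    have bound: "norm (d j u) \<le> sqrt C * r ^ j" for j
    proof -
      have "ennreal (2 ^ j * (cmod (d j u))\<^sup>2) \<le> g u"
      proof -
        have "(\<Sum>i\<in>{j}. ennreal (2 ^ i * (cmod (d i u))\<^sup>2)) \<le> g u"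
          unfolding g_def by (rule sum_le_suminf[OF summableI]) simp_all
        then show ?thesis by (simp only: sum.insert sum.empty finite.emptyI empty_iff not_False_eq_True add_0_right)
      qed
      then have "2 ^ j * (cmod (d j u))\<^sup>2 \<le> C" using C by (simp add: ennreal_le_iff)
      then have "(cmod (d j u))\<^sup>2 \<le> C * (1/2) ^ j" by (simp add: field_simps power_one_over)
      then have "sqrt ((cmod (d j u))\<^sup>2) \<le> sqrt (C * (1/2) ^ j)" by (rule real_sqrt_le_mono)
      then show ?thesis by (simp add: real_sqrt_mult r_def real_sqrt_power)
    qed
    have "summable (\<lambda>j. sqrt C * r ^ j)"
      using r by (intro summable_mult summable_geometric) simp
    then have "summable (\<lambda>j. d j u)"
      by (rule summable_comparison_test'[where N=0]) (rule bound)
    then have "convergent (\<lambda>j. F 0 u + (\<Sum>i<j. d i u))"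
      by (intro convergent_add convergent_const) (simp add: summable_iff_convergent)
    moreover have "F 0 u + (\<Sum>i<j. d i u) = F j u" for j
      unfolding d_def by (subst sum_lessThan_telescope) simp
    ultimately show ?case by (simp add: convergent_LIMSEQ_iff)
  qed
  moreover have "(\<lambda>u. lim (\<lambda>j. F j u)) \<in> borel_measurable borel" by measurable
  ultimately show ?thesis by (intro bexI[of _ "\<lambda>u. lim (\<lambda>j. F j u)"])
qed

lemma is_frft_mean_limit_iff:
  "is_frft_mean_limit \<theta> x F \<longleftrightarrow> F \<in> borel_measurable borel \<and> l2sq F < \<infinity> \<and>
     ((\<lambda>R. l2sq (\<lambda>u. frft_int \<theta> (trunc R x) u - F u)) \<longlongrightarrow> 0) at_top"
  unfolding is_frft_mean_limit_def square_integrable_iff frft_int_trunc l2sq_def by simp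

lemma l2sq_frft_int_trunc_diff_le:
  assumes x: "square_integrable x" and c: "csc \<theta> \<noteq> 0"
  shows "l2sq (\<lambda>u. frft_int \<theta> (trunc R x) u - frft_int \<theta> (trunc S x) u)
    \<le> ennreal (frft_const \<theta>) * l2sq (\<lambda>t. x t - trunc (min R S) x t)"
proof -
  have "l2sq (\<lambda>u. frft_int \<theta> (trunc R x) u - frft_int \<theta> (trunc S x) u)
      = l2sq (frft_int \<theta> (\<lambda>t. trunc R x t - trunc S x t))"
    by (intro arg_cong[where f=l2sq] ext) (simp only: frft_int_diff integrable_trunc[OF x])
  also have "\<dots> \<le> ennreal (frft_const \<theta>) * l2sq (\<lambda>t. trunc R x t - trunc S x t)"
    by (intro l2sq_frft_int_le Bochner_Integration.integrable_diff integrable_trunc x c)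
  also have "\<dots> \<le> ennreal (frft_const \<theta>) * l2sq (\<lambda>t. x t - trunc (min R S) x t)"
    by (intro mult_left_mono l2sq_mono) (auto simp: trunc_def indicator_def)
  finally show ?thesis .
qed

theorem frft_mean_limit_exists:
  assumes x: "square_integrable x" and c: "csc \<theta> \<noteq> 0"
  shows "\<exists>F. is_frft_mean_limit \<theta> x F"
proof -
  have [measurable]: "x \<in> borel_measurable borel" using x by (simp add: square_integrable_iff)
  define K where "K = (\<lambda>R. ennreal (frft_const \<theta>) * l2sq (\<lambda>t. x t - trunc R x t))"
  have K: "(K \<longlongrightarrow> 0) at_top"
    using ennreal_tendsto_cmult[OF _ l2sq_trunc_tendsto[OF x], of "ennreal (frft_const \<theta>)"]
    by (simp add: K_def)
  define T where "T = (\<lambda>R. frft_int \<theta> (trunc R x))"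
  have [measurable]: "T R \<in> borel_measurable borel" for R unfolding T_def by measurable
  have T: "l2sq (\<lambda>u. T R u - T S u) \<le> K (min R S)" for R S
    using l2sq_frft_int_trunc_diff_le[OF x c] by (simp add: T_def K_def)
  have "\<exists>R. K R \<le> ennreal ((1/4) ^ j) \<and> 0 \<le> R" for j
  proof -
    have "\<forall>\<^sub>F R in at_top. K R < ennreal ((1/4) ^ j)"
      using K by (rule order_tendstoD) simp
    then have "\<forall>\<^sub>F R in at_top. K R \<le> ennreal ((1/4) ^ j) \<and> 0 \<le> R"
      using eventually_ge_at_top[of 0] by eventually_elim simp
    then show ?thesis by (rule eventually_happens'[OF trivial_limit_at_top_linorder])
  qed
  then obtain r where r: "\<And>j. K (r j) \<le> ennreal ((1/4) ^ j)" by metis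
  have "l2sq (\<lambda>u. T (r (Suc j)) u - T (r j) u) \<le> ennreal ((1/4) ^ j)" for j
  proof -
    have "K (r (Suc j)) \<le> ennreal ((1/4) ^ j)"
      using r[of "Suc j"] by (rule order_trans) (simp add: ennreal_leI)
    then have "K (min (r (Suc j)) (r j)) \<le> ennreal ((1/4) ^ j)"
      using r[of j] by (simp add: min_def)
    then show ?thesis using T order_trans by blast
  qed
  then obtain G where [measurable]: "G \<in> borel_measurable borel"
    and G: "AE u in lborel. (\<lambda>j. T (r j) u) \<longlonglongrightarrow> G u"
    using l2_cauchy_AE_convergent[of "\<lambda>j. T (r j)"] by auto
  \<comment> \<open>Fatou's lemma turns the limit along the chosen radii into a bound for all radii.\<close>
  have le: "l2sq (\<lambda>u. T R u - G u) \<le> K R" for R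
  proof -
    have "l2sq (\<lambda>u. T R u - G u) = (\<integral>\<^sup>+ u. liminf (\<lambda>j. ennreal ((cmod (T R u - T (r j) u))\<^sup>2)) \<partial>lborel)"
      unfolding l2sq_def
    proof (rule nn_integral_cong_AE, use G in eventually_elim)
      case (elim u)
      then show ?case
        by (intro lim_imp_Liminf[symmetric] tendsto_intros) simp_all
    qed
    also have "\<dots> \<le> liminf (\<lambda>j. l2sq (\<lambda>u. T R u - T (r j) u))"
      unfolding l2sq_def by (rule nn_integral_liminf) measurable
    also have "\<dots> \<le> liminf (\<lambda>j. K R + ennreal ((1/4) ^ j))"
    proof (intro Liminf_mono always_eventually allI)
      fix j
      have "K (min R (r j)) \<le> K R + ennreal ((1/4) ^ j)"
        using r[of j] by (auto simp: min_def intro: add_increasing add_increasing2)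
      then show "l2sq (\<lambda>u. T R u - T (r j) u) \<le> K R + ennreal ((1/4) ^ j)" using T order_trans by blast
    qed
    also have "\<dots> = K R + ennreal 0"
      by (intro lim_imp_Liminf tendsto_intros tendsto_ennrealI LIMSEQ_realpow_zero) simp_all
    finally show ?thesis by simp
  qed
  have lim: "((\<lambda>R. l2sq (\<lambda>u. T R u - G u)) \<longlongrightarrow> 0) at_top"
    by (rule tendsto_sandwich[OF _ _ tendsto_const K]) (simp_all add: le)
  have "\<forall>\<^sub>F R in at_top. K R < ennreal 1" using K by (rule order_tendstoD) simp
  then obtain R where "K R < ennreal 1" using eventually_happens by fastforce
  then have "l2sq (\<lambda>u. G u - T R u) < \<infinity>"
    using le[of R] by (auto simp: l2sq_diff_commute[of G] intro: le_less_trans less_trans)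
  moreover have "l2sq (T R) < \<infinity>"
  proof -
    have "l2sq (T R) \<le> ennreal (frft_const \<theta>) * l2sq (trunc R x)"
      unfolding T_def by (rule l2sq_frft_int_le[OF integrable_trunc[OF x] c])
    also have "\<dots> \<le> ennreal (frft_const \<theta>) * l2sq x"
      by (intro mult_left_mono l2sq_mono norm_trunc_le) simp
    also have "\<dots> < \<infinity>" using x by (simp add: square_integrable_iff ennreal_mult_less_top)
    finally show ?thesis .
  qed
  ultimately have "2 * l2sq (\<lambda>u. G u - T R u) + 2 * l2sq (T R) < \<infinity>"
    by (simp add: ennreal_mult_less_top)
  moreover have "l2sq G \<le> 2 * l2sq (\<lambda>u. G u - T R u) + 2 * l2sq (T R)"
    using l2sq_add_le[of "\<lambda>u. G u - T R u" "T R"] by simp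
  ultimately have "l2sq G < \<infinity>" by (rule le_less_trans[rotated])
  then have "is_frft_mean_limit \<theta> x G"
    using lim unfolding is_frft_mean_limit_iff T_def by simp
  then show ?thesis by (rule exI[where x = G])
qed

lemma frft_int_is_mean_limit:
  assumes x: "square_integrable x" and xi: "integrable lborel x" and c: "csc \<theta> \<noteq> 0"
  shows "is_frft_mean_limit \<theta> x (frft_int \<theta> x)"
  unfolding is_frft_mean_limit_iff
proof (intro conjI)
  have [measurable]: "x \<in> borel_measurable borel" using x by (simp add: square_integrable_iff)
  show "frft_int \<theta> x \<in> borel_measurable borel" by measurable
  show "l2sq (frft_int \<theta> x) < \<infinity>"
    using x by (intro le_less_trans[OF l2sq_frft_int_le[OF xi c]])
      (simp add: square_integrable_iff ennreal_mult_less_top)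
  have K: "((\<lambda>R. ennreal (frft_const \<theta>) * l2sq (\<lambda>t. x t - trunc R x t)) \<longlongrightarrow> 0) at_top"
    using ennreal_tendsto_cmult[OF _ l2sq_trunc_tendsto[OF x], of "ennreal (frft_const \<theta>)"] by simp
  have "l2sq (\<lambda>u. frft_int \<theta> (trunc R x) u - frft_int \<theta> x u)
      \<le> ennreal (frft_const \<theta>) * l2sq (\<lambda>t. x t - trunc R x t)" for R
  proof -
    have "l2sq (\<lambda>u. frft_int \<theta> (trunc R x) u - frft_int \<theta> x u) = l2sq (frft_int \<theta> (\<lambda>t. trunc R x t - x t))"
      by (intro arg_cong[where f=l2sq] ext) (simp only: frft_int_diff integrable_trunc[OF x] xi)
    also have "\<dots> \<le> ennreal (frft_const \<theta>) * l2sq (\<lambda>t. trunc R x t - x t)"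
      by (intro l2sq_frft_int_le Bochner_Integration.integrable_diff integrable_trunc x xi c)
    finally show ?thesis by (simp only: l2sq_diff_commute[of x])
  qed
  then show "((\<lambda>R. l2sq (\<lambda>u. frft_int \<theta> (trunc R x) u - frft_int \<theta> x u)) \<longlongrightarrow> 0) at_top"
    by (intro tendsto_sandwich[OF _ _ tendsto_const K]) simp_all
qed

text \<open>Both branches in the definition of \<open>frft\<close> give a mean limit.\<close>

corollary frft_is_mean_limit:
  assumes "square_integrable x" and "csc \<theta> \<noteq> 0"
  shows "is_frft_mean_limit \<theta> x (frft \<theta> x)"
proof (cases "integrable lborel x")
  case True
  then have "frft \<theta> x = frft_int \<theta> x" by (simp add: frft_def frft_int_def fun_eq_iff)
  then show ?thesis using frft_int_is_mean_limit[OF assms(1) True assms(2)] by simp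
next
  case False
  then show ?thesis
    using someI_ex[OF frft_mean_limit_exists[OF assms]] by (simp add: frft_def)
qed

section \<open>Frequency marginal of square-integrable signals\<close>

lemma l2sq_eq_integral:
  assumes "square_integrable y"
  shows "l2sq y = ennreal (LBINT t. (cmod (y t))\<^sup>2)"
  using assms unfolding l2sq_def square_integrable_def by (intro nn_integral_eq_integral) auto

lemma square_integrable_trunc:
  assumes y: "square_integrable y"
  shows "square_integrable (trunc R y)"
proof -
  have [measurable]: "y \<in> borel_measurable borel" using y by (simp add: square_integrable_iff)
  show ?thesis
    using y le_less_trans[OF l2sq_mono[OF norm_trunc_le]] by (auto simp: square_integrable_iff)
qed

lemma square_integrable_chirp:
  assumes x: "square_integrable x"
  shows "square_integrable (chirp \<theta> x)"
proof -
  have [measurable]: "x \<in> borel_measurable borel" using x by (simp add: square_integrable_iff)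
  show ?thesis using x by (simp add: square_integrable_iff)
qed

lemma chirp_trunc: "chirp \<theta> (trunc R x) = trunc R (chirp \<theta> x)"
  by (simp add: chirp_def trunc_def fun_eq_iff)

lemma osc_mono: "(\<And>t. cmod (f t) \<le> cmod (g t)) \<Longrightarrow> osc \<sigma> f \<le> osc \<sigma> g"
  unfolding osc_def by (intro nn_integral_mono ennreal_leI mult_left_mono power_mono) auto

lemma osc_tendsto:
  assumes x: "square_integrable x" and a: "a > 0"
  shows "((\<lambda>\<epsilon>. osc (sqrt (2 * \<epsilon>) / (2 * a)) x) \<longlongrightarrow> 0) (at_right 0)"
proof -
  have [measurable]: "x \<in> borel_measurable borel" using x by (simp add: square_integrable_iff)
  have i: "integrable lborel (\<lambda>t. 2 * (cmod (x t))\<^sup>2)" using x by (simp add: square_integrable_def)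
  define f where "f = (\<lambda>s t. (2 - 2 * exp (- ((sqrt (2 * inverse s) / (2 * a))\<^sup>2 * t\<^sup>2 / 2))) * (cmod (x t))\<^sup>2)"
  have f0: "0 \<le> f s t" for s t by (simp add: f_def)
  have fb: "f s t \<le> 2 * (cmod (x t))\<^sup>2" for s t unfolding f_def by (rule mult_right_mono) simp_all
  have [measurable]: "f s \<in> borel_measurable borel" for s unfolding f_def by measurable
  have fi: "integrable lborel (f s)" for s
    by (rule Bochner_Integration.integrable_bound[OF i]) (auto simp: f0 fb)
  have "((\<lambda>s. LBINT t. f s t) \<longlongrightarrow> (LBINT t::real. 0)) at_top"
  proof (rule integral_dominated_convergence_at_top[OF _ _ i])
    show "AE t in lborel. ((\<lambda>s. f s t) \<longlongrightarrow> 0) at_top"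
    proof (rule AE_I2)
      fix t
      have inv: "((\<lambda>s::real. inverse s) \<longlongrightarrow> 0) at_top"
        by (rule tendsto_inverse_0_at_top[OF filterlim_ident])
      have "((\<lambda>s. sqrt (2 * inverse s) / (2 * a)) \<longlongrightarrow> sqrt (2 * 0) / (2 * a)) at_top"
        by (intro tendsto_intros inv) (use a in simp)
      moreover have "((\<lambda>s. (2 - 2 * exp (- ((g s)\<^sup>2 * t\<^sup>2 / 2))) * (cmod (x t))\<^sup>2) \<longlongrightarrow>
          (2 - 2 * exp (- (L\<^sup>2 * t\<^sup>2 / 2))) * (cmod (x t))\<^sup>2) at_top"
        if "(g \<longlongrightarrow> L) at_top" for g :: "real \<Rightarrow> real" and L
        by (intro tendsto_intros that) simp
      ultimately have "((\<lambda>s. f s t) \<longlongrightarrow>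
          (2 - 2 * exp (- ((sqrt (2 * 0) / (2 * a))\<^sup>2 * t\<^sup>2 / 2))) * (cmod (x t))\<^sup>2) at_top"
        unfolding f_def by blast
      then show "((\<lambda>s. f s t) \<longlongrightarrow> 0) at_top" by simp
    qed
    show "\<forall>\<^sub>F s in at_top. AE t in lborel. norm (f s t) \<le> 2 * (cmod (x t))\<^sup>2"
      by (intro always_eventually allI AE_I2) (simp add: f0 fb)
  qed measurable
  then have "((\<lambda>s. ennreal (LBINT t. f s t)) \<longlongrightarrow> ennreal 0) at_top"
    by (intro tendsto_ennrealI) simp
  moreover have "osc (sqrt (2 * inverse s) / (2 * a)) x = ennreal (LBINT t. f s t)" for s
    unfolding osc_def using nn_integral_eq_integral[OF fi, of s] f0 by (simp add: f_def)
  ultimately have "((\<lambda>s. osc (sqrt (2 * inverse s) / (2 * a)) x) \<longlongrightarrow> 0) at_top" by simp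
  then show ?thesis by (simp add: filterlim_at_right_to_top)
qed

lemma measurable_amb [measurable (raw)]:
  assumes [measurable]: "y \<in> borel_measurable borel" "f \<in> borel_measurable M" "g \<in> borel_measurable M"
  shows "(\<lambda>z. amb a y (f z) (g z)) \<in> borel_measurable M"
  unfolding amb_def by measurable

lemma amb_integrand_bound:
  assumes y: "square_integrable y"
  shows "integrable lborel (\<lambda>t. 1/2 * (cmod (y (t + s)))\<^sup>2 + 1/2 * (cmod (y (t - s)))\<^sup>2)"
    and "(LBINT t. 1/2 * (cmod (y (t + s)))\<^sup>2 + 1/2 * (cmod (y (t - s)))\<^sup>2) = (LBINT t. (cmod (y t))\<^sup>2)"
proof -
  have i: "integrable lborel (\<lambda>t. (cmod (y t))\<^sup>2)" using y by (simp add: square_integrable_def)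
  have 1: "integrable lborel (\<lambda>t. (cmod (y (t + s)))\<^sup>2)" for s
    using lborel_integrable_real_affine[OF i, of 1 s] by (simp add: add.commute)
  have 2: "(LBINT t. (cmod (y (t + s)))\<^sup>2) = (LBINT t. (cmod (y t))\<^sup>2)" for s
    using lborel_integral_real_affine[of 1 "\<lambda>t. (cmod (y t))\<^sup>2" s] by (simp add: add.commute)
  show "integrable lborel (\<lambda>t. 1/2 * (cmod (y (t + s)))\<^sup>2 + 1/2 * (cmod (y (t - s)))\<^sup>2)"
    using 1[of s] 1[of "- s"] by simp
  show "(LBINT t. 1/2 * (cmod (y (t + s)))\<^sup>2 + 1/2 * (cmod (y (t - s)))\<^sup>2) = (LBINT t. (cmod (y t))\<^sup>2)"
    using 1[of s] 1[of "- s"] 2[of s] 2[of "- s"] by (subst Bochner_Integration.integral_add) simp_all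
qed

lemma norm_amb_integrand_le:
  "cmod (p * cnj q * cis r) \<le> 1/2 * (cmod p)\<^sup>2 + 1/2 * (cmod q)\<^sup>2"
  using sum_squares_bound[of "cmod p" "cmod q"] by (simp add: norm_mult)

lemma norm_amb_le:
  assumes y: "square_integrable y"
  shows "cmod (amb a y \<tau> v) \<le> (LBINT t. (cmod (y t))\<^sup>2)"
proof -
  have [measurable]: "y \<in> borel_measurable borel" using y by (simp add: square_integrable_iff)
  note b = amb_integrand_bound[OF y, of "a * \<tau>"]
  have i: "integrable lborel (\<lambda>t. y (t + a * \<tau>) * cnj (y (t - a * \<tau>)) * cis (- (v * t)))"
    by (rule Bochner_Integration.integrable_bound[OF b(1)])
       (use norm_amb_integrand_le in \<open>auto simp del: norm_mult intro: order_trans\<close>)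
  have "cmod (amb a y \<tau> v) \<le> (LBINT t. cmod (y (t + a * \<tau>) * cnj (y (t - a * \<tau>)) * cis (- (v * t))))"
    unfolding amb_def by (rule integral_norm_bound)
  also have "\<dots> \<le> (LBINT t. 1/2 * (cmod (y (t + a * \<tau>)))\<^sup>2 + 1/2 * (cmod (y (t - a * \<tau>)))\<^sup>2)"
    by (intro integral_mono integrable_norm i b(1) norm_amb_integrand_le)
  finally show ?thesis unfolding b(2) .
qed

lemma trunc_nat_tendsto: "(\<lambda>n. trunc (real n) y t) \<longlonglongrightarrow> y t"
  using trunc_tendsto filterlim_real_sequentially by (rule filterlim_compose)

lemma amb_trunc_tendsto:
  assumes y: "square_integrable y"
  shows "(\<lambda>n. amb a (trunc (real n) y) \<tau> v) \<longlonglongrightarrow> amb a y \<tau> v"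
  unfolding amb_def
proof (rule integral_dominated_convergence)
  have [measurable]: "y \<in> borel_measurable borel" using y by (simp add: square_integrable_iff)
  show "(\<lambda>t. y (t + a * \<tau>) * cnj (y (t - a * \<tau>)) * cis (- (v * t))) \<in> borel_measurable lborel"
    by measurable
  show "(\<lambda>t. trunc (real n) y (t + a * \<tau>) * cnj (trunc (real n) y (t - a * \<tau>)) * cis (- (v * t)))
      \<in> borel_measurable lborel" for n
    by measurable
  show "integrable lborel (\<lambda>t. 1/2 * (cmod (y (t + a * \<tau>)))\<^sup>2 + 1/2 * (cmod (y (t - a * \<tau>)))\<^sup>2)"
    by (rule amb_integrand_bound[OF y])
  show "AE t in lborel. (\<lambda>n. trunc (real n) y (t + a * \<tau>) * cnj (trunc (real n) y (t - a * \<tau>)) * cis (- (v * t)))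
      \<longlonglongrightarrow> y (t + a * \<tau>) * cnj (y (t - a * \<tau>)) * cis (- (v * t))"
    by (intro AE_I2 tendsto_intros trunc_nat_tendsto)
  show "AE t in lborel. norm (trunc (real n) y (t + a * \<tau>) * cnj (trunc (real n) y (t - a * \<tau>)) * cis (- (v * t)))
      \<le> 1/2 * (cmod (y (t + a * \<tau>)))\<^sup>2 + 1/2 * (cmod (y (t - a * \<tau>)))\<^sup>2" for n
    by (intro AE_I2 order_trans[OF norm_amb_integrand_le] add_mono mult_left_mono power_mono norm_trunc_le) simp_all
qed

lemma integrable_gaussian:
  fixes \<epsilon> :: real
  assumes "\<epsilon> > 0"
  shows "integrable lborel (\<lambda>\<tau>. exp (- \<epsilon> * \<tau>\<^sup>2))"
proof -
  let ?\<sigma> = "1 / sqrt (2 * \<epsilon>)"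
  have "exp (- \<epsilon> * \<tau>\<^sup>2) = sqrt (2 * pi * ?\<sigma>\<^sup>2) * normal_density 0 ?\<sigma> \<tau>" for \<tau>
    using assms by (simp add: normal_density_def power_divide)
  then show ?thesis using assms by (simp add: integrable_mult_right)
qed

lemma damped_amb_trunc_tendsto:
  fixes \<epsilon> :: real
  assumes y: "square_integrable y" and \<epsilon>: "\<epsilon> > 0"
  shows "(\<lambda>n. LBINT \<tau>. of_real (exp (- \<epsilon> * \<tau>\<^sup>2)) * amb a (trunc (real n) y) \<tau> v)
    \<longlonglongrightarrow> (LBINT \<tau>. of_real (exp (- \<epsilon> * \<tau>\<^sup>2)) * amb a y \<tau> v)"
proof (rule integral_dominated_convergence)
  have [measurable]: "y \<in> borel_measurable borel" using y by (simp add: square_integrable_iff)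
  let ?S = "LBINT t. (cmod (y t))\<^sup>2"
  show "(\<lambda>\<tau>. of_real (exp (- \<epsilon> * \<tau>\<^sup>2)) * amb a y \<tau> v) \<in> borel_measurable lborel"
    by measurable
  show "(\<lambda>\<tau>. of_real (exp (- \<epsilon> * \<tau>\<^sup>2)) * amb a (trunc (real n) y) \<tau> v) \<in> borel_measurable lborel" for n
    by measurable
  show "integrable lborel (\<lambda>\<tau>. exp (- \<epsilon> * \<tau>\<^sup>2) * ?S)"
    by (intro integrable_mult_left integrable_gaussian \<epsilon>)
  show "AE \<tau> in lborel. (\<lambda>n. of_real (exp (- \<epsilon> * \<tau>\<^sup>2)) * amb a (trunc (real n) y) \<tau> v)
      \<longlonglongrightarrow> of_real (exp (- \<epsilon> * \<tau>\<^sup>2)) * amb a y \<tau> v"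
    by (intro AE_I2 tendsto_intros amb_trunc_tendsto y)
  show "AE \<tau> in lborel. norm (of_real (exp (- \<epsilon> * \<tau>\<^sup>2)) * amb a (trunc (real n) y) \<tau> v)
      \<le> exp (- \<epsilon> * \<tau>\<^sup>2) * ?S" for n
  proof (rule AE_I2)
    fix \<tau>
    have "cmod (amb a (trunc (real n) y) \<tau> v) \<le> (LBINT t. (cmod (trunc (real n) y t))\<^sup>2)"
      by (rule norm_amb_le[OF square_integrable_trunc[OF y]])
    also have "\<dots> \<le> ?S"
      using y square_integrable_trunc[OF y, of "real n"] unfolding square_integrable_def
      by (intro integral_mono power_mono norm_trunc_le) auto
    finally show "norm (of_real (exp (- \<epsilon> * \<tau>\<^sup>2)) * amb a (trunc (real n) y) \<tau> v) \<le> exp (- \<epsilon> * \<tau>\<^sup>2) * ?S"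
      by (simp add: norm_mult)
  qed
qed

text \<open>The constants \<open>C\<close> and \<open>K\<close> do not depend on \<open>\<epsilon>\<close> and \<open>\<delta>\<close>: choosing \<open>\<delta>\<close> small first and then letting
  \<open>\<epsilon>\<close> tend to 0 makes the bound as small as desired.\<close>

lemma damped_marginal_L1_bound:
  assumes x: "square_integrable x" and k: "k > 0" and c: "csc \<theta> \<noteq> 0"
    and F: "is_frft_mean_limit \<theta> x F"
  obtains C K :: real where "C \<ge> 0" "K \<ge> 0"
    "\<And>\<epsilon> \<delta>. \<epsilon> > 0 \<Longrightarrow> \<delta> > 0 \<Longrightarrow>
      (\<integral>\<^sup>+ u. ennreal (cmod ((LBINT \<tau>. of_real (exp (- \<epsilon> * \<tau>\<^sup>2)) * nfraf \<theta> k x \<tau> u)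
          - 1 / of_real k * F (u / 2) * cnj (F (- u / 2)))) \<partial>lborel)
      \<le> ennreal (C * \<delta>) + ennreal (K / \<delta>) * osc (sqrt (2 * \<epsilon>) / k) x"
proof -
  have [measurable]: "x \<in> borel_measurable borel" using x by (simp add: square_integrable_iff)
  have [measurable]: "F \<in> borel_measurable borel" using F by (simp add: is_frft_mean_limit_iff)
  define y where "y = chirp \<theta> x"
  have y: "square_integrable y" unfolding y_def by (rule square_integrable_chirp[OF x])
  have [measurable]: "y \<in> borel_measurable borel" using y by (simp add: square_integrable_iff)
  define w where "w = (cmod (Omega \<theta>))\<^sup>2"
  have w: "w \<ge> 0" by (simp add: w_def)
  define a where "a = k / 2"
  have a: "a > 0" "2 * a = k" using k by (simp_all add: a_def)
  define T where "T = (\<lambda>n::nat. frft_int \<theta> (trunc (real n) x))"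
  have [measurable]: "T n \<in> borel_measurable borel" for n unfolding T_def by measurable
  define X where "X = (LBINT t. (cmod (x t))\<^sup>2)"
  have X: "X \<ge> 0" "l2sq x = ennreal X" by (simp_all add: X_def l2sq_eq_integral[OF x])
  define Y where "Y = enn2real (l2sq F)"
  have Y: "Y \<ge> 0" "l2sq F = ennreal Y" using F by (simp_all add: Y_def is_frft_mean_limit_iff)
  define K where "K = w * (2 * pi / (a * \<bar>csc \<theta>\<bar>))"
  have K: "K \<ge> 0" using w a by (simp add: K_def)
  define M where "M = frft_const \<theta>"
  have M: "M \<ge> 0" by (simp add: M_def frft_const_nonneg)
  define C where "C = K * X + (M * X + Y) / k"
  have C: "C \<ge> 0" using K X M Y k by (simp add: C_def)
  define G where "G = (\<lambda>\<epsilon> u. of_real w * (LBINT \<tau>. of_real (exp (- \<epsilon> * \<tau>\<^sup>2)) * amb a y \<tau> (u * csc \<theta>)))"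
  define Gn where "Gn = (\<lambda>n::nat. \<lambda>\<epsilon> u. of_real w * (LBINT \<tau>. of_real (exp (- \<epsilon> * \<tau>\<^sup>2)) * amb a (trunc (real n) y) \<tau> (u * csc \<theta>)))"
  have [measurable]: "Gn n \<epsilon> \<in> borel_measurable borel" for n \<epsilon> unfolding Gn_def by measurable
  have G_eq: "(LBINT \<tau>. of_real (exp (- \<epsilon> * \<tau>\<^sup>2)) * nfraf \<theta> k x \<tau> u) = G \<epsilon> u" for \<epsilon> u
    unfolding nfraf_eq_amb G_def w_def a_def y_def
    by (subst integral_mult_right_zero[symmetric]) (simp only: mult.left_commute)
  define R where "R = (\<lambda>u. 1 / of_real k * F (u / 2) * cnj (F (- u / 2)))"
  have [measurable]: "R \<in> borel_measurable borel" unfolding R_def by measurable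
  define Rn where "Rn = (\<lambda>n u. 1 / of_real k * T n (u / 2) * cnj (T n (- u / 2)))"
  have [measurable]: "Rn n \<in> borel_measurable borel" for n unfolding Rn_def by measurable
  have Rn_eq: "Rn n u = of_real w * (of_real (1 / (2 * a)) *
      (ft (trunc (real n) y) (u * csc \<theta> / 2) * cnj (ft (trunc (real n) y) (- (u * csc \<theta> / 2)))))" for n u
    using frft_int_product[of \<theta> "trunc (real n) x" u]
    unfolding Rn_def T_def y_def w_def a(2) chirp_trunc mult.assoc by (simp add: mult_ac)
  have half: "l2sq (\<lambda>u. f (u / 2)) = 2 * l2sq f" "l2sq (\<lambda>u. f (- u / 2)) = 2 * l2sq f"
    if "f \<in> borel_measurable borel" for f
    using l2sq_affine[OF that, of "1/2" 0] l2sq_affine[OF that, of "-1/2" 0] by simp_all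

  \<comment> \<open>The estimate for the truncated signal, uniform in \<open>n\<close>.\<close>
  have bound1: "(\<integral>\<^sup>+ u. ennreal (cmod (Gn n \<epsilon> u - Rn n u)) \<partial>lborel)
      \<le> ennreal (K * X * \<delta>) + ennreal (K / \<delta>) * osc (sqrt (2 * \<epsilon>) / k) x"
    if \<epsilon>: "\<epsilon> > 0" and \<delta>: "\<delta> > 0" for n \<epsilon> \<delta>
  proof -
    let ?y = "trunc (real n) y"
    have i: "integrable lborel ?y" by (rule integrable_trunc[OF y])
    let ?D = "\<lambda>u. (LBINT \<tau>. of_real (exp (- \<epsilon> * \<tau>\<^sup>2)) * amb a ?y \<tau> (u * csc \<theta>))
            - of_real (1 / (2 * a)) * (ft ?y (u * csc \<theta> / 2) * cnj (ft ?y (- (u * csc \<theta> / 2))))"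
    have "(\<integral>\<^sup>+ u. ennreal (cmod (Gn n \<epsilon> u - Rn n u)) \<partial>lborel)
        = (\<integral>\<^sup>+ u. ennreal w * ennreal (cmod (?D u)) \<partial>lborel)"
      unfolding Gn_def Rn_eq right_diff_distrib[symmetric] norm_mult norm_of_real abs_of_nonneg[OF w]
      by (intro nn_integral_cong ennreal_mult' w)
    also have "\<dots> = ennreal w * (\<integral>\<^sup>+ u. ennreal (cmod (?D u)) \<partial>lborel)"
      by (rule nn_integral_cmult) measurable
    also have "\<dots> \<le> ennreal w * (ennreal (2 * pi / (a * \<bar>csc \<theta>\<bar>)) *
        (ennreal \<delta> * l2sq ?y + ennreal (1 / \<delta>) * osc (sqrt (2 * \<epsilon>) / (2 * a)) ?y))"
      by (intro mult_left_mono nn_integral_amb_damped_marginal_le i a \<epsilon> c \<delta>) simp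
    also have "\<dots> \<le> ennreal w * (ennreal (2 * pi / (a * \<bar>csc \<theta>\<bar>)) *
        (ennreal \<delta> * l2sq y + ennreal (1 / \<delta>) * osc (sqrt (2 * \<epsilon>) / (2 * a)) y))"
      by (intro mult_left_mono add_mono l2sq_mono osc_mono norm_trunc_le) simp_all
    also have "\<dots> = ennreal K * (ennreal \<delta> * l2sq x + ennreal (1 / \<delta>) * osc (sqrt (2 * \<epsilon>) / k) x)"
    proof -
      have "0 \<le> 2 * pi / (a * \<bar>csc \<theta>\<bar>)" using a by simp
      then show ?thesis
        unfolding K_def a(2) y_def l2sq_chirp osc_chirp by (simp only: ennreal_mult w mult.assoc)
    qed
    also have "\<dots> = ennreal (K * X * \<delta>) + ennreal (K / \<delta>) * osc (sqrt (2 * \<epsilon>) / k) x"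
    proof -
      have "K * X * \<delta> = K * (\<delta> * X)" "K / \<delta> = K * (1 / \<delta>)" by simp_all
      moreover have "0 \<le> \<delta>" "0 \<le> 1 / \<delta>" "0 \<le> \<delta> * X" using \<delta> X by simp_all
      ultimately show ?thesis
        unfolding X by (simp only: ennreal_mult K X distrib_left mult.assoc)
    qed
    finally show ?thesis .
  qed

  \<comment> \<open>The distance between the limit marginals of the truncated and of the full signal.\<close>
  have bound2: "(\<integral>\<^sup>+ u. ennreal (cmod (Rn n u - R u)) \<partial>lborel)
      \<le> ennreal ((M * X + Y) / k * \<delta>) + ennreal (2 / (k * \<delta>)) * l2sq (\<lambda>u. T n u - F u)"
    if \<delta>: "\<delta> > 0" for n \<delta>
  proof -
    have k': "0 \<le> 1 / k" using k by simp
    have nk: "cmod (1 / of_real k) = 1 / k" using k by (simp add: norm_divide)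
    have "l2sq (T n) \<le> ennreal M * l2sq (trunc (real n) x)"
      unfolding T_def M_def by (rule l2sq_frft_int_le[OF integrable_trunc[OF x] c])
    also have "\<dots> \<le> ennreal M * l2sq x"
      by (intro mult_left_mono l2sq_mono norm_trunc_le) simp
    also have "\<dots> = ennreal (M * X)" using M X by (simp add: ennreal_mult)
    finally have Tn: "l2sq (T n) \<le> ennreal (M * X)" .
    let ?D = "\<lambda>u. T n (u / 2) * cnj (T n (- u / 2)) - F (u / 2) * cnj (F (- u / 2))"
    have "(\<integral>\<^sup>+ u. ennreal (cmod (Rn n u - R u)) \<partial>lborel) = (\<integral>\<^sup>+ u. ennreal (1 / k) * ennreal (cmod (?D u)) \<partial>lborel)"
      unfolding Rn_def R_def mult.assoc right_diff_distrib[symmetric] norm_mult nk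
      by (intro nn_integral_cong ennreal_mult' k')
    also have "\<dots> = ennreal (1 / k) * (\<integral>\<^sup>+ u. ennreal (cmod (?D u)) \<partial>lborel)"
      by (rule nn_integral_cmult) measurable
    also have "\<dots> \<le> ennreal (1 / k) * (ennreal (\<delta> / 2) * (l2sq (\<lambda>u. T n (- u / 2)) + l2sq (\<lambda>u. F (u / 2)))
      + ennreal (1 / (2 * \<delta>)) * (l2sq (\<lambda>u. T n (u / 2) - F (u / 2)) + l2sq (\<lambda>u. T n (- u / 2) - F (- u / 2))))"
      by (intro mult_left_mono nn_integral_product_diff_le[OF \<delta>]; measurable)
    also have "\<dots> = ennreal (1 / k) * (ennreal (\<delta> / 2) * (2 * l2sq (T n) + 2 * ennreal Y)
      + ennreal (1 / (2 * \<delta>)) * (2 * l2sq (\<lambda>u. T n u - F u) + 2 * l2sq (\<lambda>u. T n u - F u)))"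
      using half[of "T n"] half[of F] half[of "\<lambda>u. T n u - F u"] by (simp add: Y)
    also have "\<dots> \<le> ennreal (1 / k) * (ennreal (\<delta> / 2) * (2 * ennreal (M * X) + 2 * ennreal Y)
      + ennreal (1 / (2 * \<delta>)) * (2 * l2sq (\<lambda>u. T n u - F u) + 2 * l2sq (\<lambda>u. T n u - F u)))"
      by (intro mult_left_mono add_mono Tn) simp_all
    also have "\<dots> = ennreal ((M * X + Y) / k * \<delta>) + ennreal (2 / (k * \<delta>)) * l2sq (\<lambda>u. T n u - F u)"
    proof -
      let ?l = "l2sq (\<lambda>u. T n u - F u)"
      have "ennreal (\<delta> / 2) * (2 * ennreal (M * X) + 2 * ennreal Y) = ennreal (\<delta> / 2 * (2 * (M * X) + 2 * Y))"
      proof -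
        have e2: "2 * ennreal z = ennreal (2 * z)" for z by (simp add: ennreal_mult')
        have "0 \<le> \<delta> / 2" "0 \<le> 2 * (M * X)" "0 \<le> 2 * Y" using \<delta> M X(1) Y(1) by simp_all
        then show ?thesis unfolding e2 by (simp only: ennreal_mult' ennreal_plus)
      qed
      moreover have "2 * ?l + 2 * ?l = ennreal 4 * ?l"
        by (simp flip: distrib_right)
      moreover have "ennreal (1 / (2 * \<delta>)) * (ennreal 4 * ?l) = ennreal (1 / (2 * \<delta>) * 4) * ?l"
        using \<delta> by (simp only: mult.assoc[symmetric]) (subst ennreal_mult, simp_all)
      moreover have "ennreal (1 / k) * (ennreal (\<delta> / 2 * (2 * (M * X) + 2 * Y)) + ennreal (1 / (2 * \<delta>) * 4) * ?l)
         = ennreal (1 / k * (\<delta> / 2 * (2 * (M * X) + 2 * Y))) + ennreal (1 / k * (1 / (2 * \<delta>) * 4)) * ?l"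
      proof -
        have "ennreal p * (ennreal q + ennreal r * l) = ennreal (p * q) + ennreal (p * r) * l"
          if "p \<ge> 0" for p q r :: real and l :: ennreal
          by (simp only: distrib_left ennreal_mult'[OF that] mult.assoc)
        then show ?thesis using k' by blast
      qed
      moreover have "1 / k * (\<delta> / 2 * (2 * (M * X) + 2 * Y)) = (M * X + Y) / k * \<delta>"
        "1 / k * (1 / (2 * \<delta>) * 4) = 2 / (k * \<delta>)"
        by (simp_all add: algebra_simps add_divide_distrib)
      ultimately show ?thesis by simp
    qed
    finally show ?thesis .
  qed

  have lim0: "(\<lambda>n. l2sq (\<lambda>u. T n u - F u)) \<longlonglongrightarrow> 0"
    using F filterlim_compose[OF _ filterlim_real_sequentially,
        of "\<lambda>R. l2sq (\<lambda>u. frft_int \<theta> (trunc R x) u - F u)"]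
    unfolding T_def is_frft_mean_limit_iff by auto

  have main: "(\<integral>\<^sup>+ u. ennreal (cmod (G \<epsilon> u - R u)) \<partial>lborel)
      \<le> ennreal (C * \<delta>) + ennreal (K / \<delta>) * osc (sqrt (2 * \<epsilon>) / k) x"
    if \<epsilon>: "\<epsilon> > 0" and \<delta>: "\<delta> > 0" for \<epsilon> \<delta>
  proof -
    let ?B = "ennreal (K * X * \<delta>) + ennreal (K / \<delta>) * osc (sqrt (2 * \<epsilon>) / k) x + ennreal ((M * X + Y) / k * \<delta>)"
    have "(\<lambda>n. Gn n \<epsilon> u) \<longlonglongrightarrow> G \<epsilon> u" for u
      unfolding Gn_def G_def by (intro tendsto_intros damped_amb_trunc_tendsto y \<epsilon>)
    then have "(\<lambda>n. ennreal (cmod (Gn n \<epsilon> u - R u))) \<longlonglongrightarrow> ennreal (cmod (G \<epsilon> u - R u))" for u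
      by (intro tendsto_intros)
    then have "(\<integral>\<^sup>+ u. ennreal (cmod (G \<epsilon> u - R u)) \<partial>lborel)
        = (\<integral>\<^sup>+ u. liminf (\<lambda>n. ennreal (cmod (Gn n \<epsilon> u - R u))) \<partial>lborel)"
      by (intro nn_integral_cong lim_imp_Liminf[symmetric]) simp_all
    also have "\<dots> \<le> liminf (\<lambda>n. \<integral>\<^sup>+ u. ennreal (cmod (Gn n \<epsilon> u - R u)) \<partial>lborel)"
      by (rule nn_integral_liminf) measurable
    also have "\<dots> \<le> liminf (\<lambda>n. ?B + ennreal (2 / (k * \<delta>)) * l2sq (\<lambda>u. T n u - F u))"
    proof (intro Liminf_mono always_eventually allI)
      fix n
      have "(\<integral>\<^sup>+ u. ennreal (cmod (Gn n \<epsilon> u - R u)) \<partial>lborel)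
          \<le> (\<integral>\<^sup>+ u. ennreal (cmod (Gn n \<epsilon> u - Rn n u)) + ennreal (cmod (Rn n u - R u)) \<partial>lborel)"
        by (intro nn_integral_mono) (metis ennreal_leI ennreal_plus norm_ge_zero norm_diff_triangle_ineq
            diff_add_cancel norm_triangle_ineq add_diff_eq)
      also have "\<dots> = (\<integral>\<^sup>+ u. ennreal (cmod (Gn n \<epsilon> u - Rn n u)) \<partial>lborel) + (\<integral>\<^sup>+ u. ennreal (cmod (Rn n u - R u)) \<partial>lborel)"
        by (rule nn_integral_add) measurable
      also have "\<dots> \<le> (ennreal (K * X * \<delta>) + ennreal (K / \<delta>) * osc (sqrt (2 * \<epsilon>) / k) x)
         + (ennreal ((M * X + Y) / k * \<delta>) + ennreal (2 / (k * \<delta>)) * l2sq (\<lambda>u. T n u - F u))"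
        by (intro add_mono bound1 bound2 \<epsilon> \<delta>)
      finally show "(\<integral>\<^sup>+ u. ennreal (cmod (Gn n \<epsilon> u - R u)) \<partial>lborel)
          \<le> ?B + ennreal (2 / (k * \<delta>)) * l2sq (\<lambda>u. T n u - F u)"
        by (simp only: add.assoc)
    qed
    also have "\<dots> = ?B + 0"
    proof (intro lim_imp_Liminf tendsto_add tendsto_const)
      show "(\<lambda>n. ennreal (2 / (k * \<delta>)) * l2sq (\<lambda>u. T n u - F u)) \<longlonglongrightarrow> 0"
        using ennreal_tendsto_cmult[OF _ lim0, of "ennreal (2 / (k * \<delta>))"] by simp
    qed simp
    also have "?B + 0 = ennreal (C * \<delta>) + ennreal (K / \<delta>) * osc (sqrt (2 * \<epsilon>) / k) x"
    proof -
      have "0 \<le> K * X * \<delta>" "0 \<le> (M * X + Y) / k * \<delta>" using K X M Y k \<delta> by simp_all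
      then have "ennreal (C * \<delta>) = ennreal (K * X * \<delta>) + ennreal ((M * X + Y) / k * \<delta>)"
        unfolding C_def distrib_right by (rule ennreal_plus)
      then show ?thesis by (simp add: add_ac)
    qed
    finally show ?thesis .
  qed
  show thesis
    by (rule that[OF C K]) (unfold G_eq, rule main[unfolded R_def])
qed

lemma damped_marginal_tendsto_L1:
  assumes x: "square_integrable x" and k: "k > 0" and c: "csc \<theta> \<noteq> 0"
    and F: "is_frft_mean_limit \<theta> x F"
  shows "((\<lambda>\<epsilon>. \<integral>\<^sup>+ u. ennreal (cmod
              ((LBINT \<tau>. of_real (exp (- \<epsilon> * \<tau>\<^sup>2)) * nfraf \<theta> k x \<tau> u)
               - 1 / of_real k * F (u / 2) * cnj (F (- u / 2)))) \<partial>lborel)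
            \<longlongrightarrow> 0) (at_right 0)"
    (is "(?H \<longlongrightarrow> 0) _")
proof -
  obtain C K :: real where C: "C \<ge> 0" and K: "K \<ge> 0"
    and le: "\<And>\<epsilon> \<delta>. \<epsilon> > 0 \<Longrightarrow> \<delta> > 0 \<Longrightarrow> ?H \<epsilon> \<le> ennreal (C * \<delta>) + ennreal (K / \<delta>) * osc (sqrt (2 * \<epsilon>) / k) x"
    using damped_marginal_L1_bound[OF assms] by blast
  have osc: "((\<lambda>\<epsilon>. osc (sqrt (2 * \<epsilon>) / k) x) \<longlongrightarrow> 0) (at_right 0)"
    using osc_tendsto[OF x, of "k / 2"] k by simp
  show ?thesis
  proof (rule order_tendstoI)
    fix b :: ennreal assume "0 < b"
    then obtain b' where b': "0 < b'" "b' < b" using dense by blast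
    then obtain e where e: "b' = ennreal e" "e > 0" by (cases b') (auto simp: ennreal_zero_less_top)
    define \<delta> where "\<delta> = e / (2 * (C + 1))"
    have \<delta>: "\<delta> > 0" using C e by (simp add: \<delta>_def)
    have "C * \<delta> \<le> e / 2" using C e by (simp add: \<delta>_def field_simps)
    have "((\<lambda>\<epsilon>. ennreal (K / \<delta>) * osc (sqrt (2 * \<epsilon>) / k) x) \<longlongrightarrow> ennreal (K / \<delta>) * 0) (at_right 0)"
      by (intro ennreal_tendsto_cmult osc) simp
    moreover have "ennreal (K / \<delta>) * 0 < ennreal (e / 2)"
      unfolding mult_zero_right ennreal_less_zero_iff using e by simp
    ultimately have "\<forall>\<^sub>F \<epsilon> in at_right 0. ennreal (K / \<delta>) * osc (sqrt (2 * \<epsilon>) / k) x < ennreal (e / 2)"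
      by (rule order_tendstoD(2))
    then show "\<forall>\<^sub>F \<epsilon> in at_right 0. ?H \<epsilon> < b"
      using eventually_at_right_less[of 0]
    proof eventually_elim
      case (elim \<epsilon>)
      have "?H \<epsilon> \<le> ennreal (C * \<delta>) + ennreal (K / \<delta>) * osc (sqrt (2 * \<epsilon>) / k) x"
        using elim \<delta> by (intro le) simp_all
      also have "\<dots> \<le> ennreal (e / 2) + ennreal (e / 2)"
        using elim \<open>C * \<delta> \<le> e / 2\<close> by (intro add_mono ennreal_leI) simp_all
      also have "\<dots> = b'" using e by (subst ennreal_plus[symmetric]) simp_all
      finally show ?case using b' by simp
    qed
  qed simp
qed

text \<open>Along \<open>\<epsilon> = 1 / Suc n\<close> the lower limit of the errors vanishes almost everywhere by Fatou's lemma.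
  Where the undamped integral exists, dominated convergence shows that the errors converge, so the limit
  error is 0; measurability of the set of such \<open>u\<close> plays no part.\<close>

lemma marginal_AE_of_damped:
  assumes x: "square_integrable x" and [measurable]: "R \<in> borel_measurable borel"
    and lim: "((\<lambda>\<epsilon>. \<integral>\<^sup>+ u. ennreal (cmod
              ((LBINT \<tau>. of_real (exp (- \<epsilon> * \<tau>\<^sup>2)) * nfraf \<theta> k x \<tau> u) - R u)) \<partial>lborel) \<longlongrightarrow> 0) (at_right 0)"
  shows "AE u in lborel. integrable lborel (\<lambda>\<tau>. nfraf \<theta> k x \<tau> u) \<longrightarrow> (LBINT \<tau>. nfraf \<theta> k x \<tau> u) = R u"
proof -
  have [measurable]: "x \<in> borel_measurable borel" using x by (simp add: square_integrable_iff)
  define e where "e = (\<lambda>n. 1 / real (Suc n))"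
  have e0: "e \<longlonglongrightarrow> 0" unfolding e_def by real_asymp
  then have e: "filterlim e (at_right 0) sequentially"
    by (rule tendsto_imp_filterlim_at_right) (simp add: e_def)
  define G where "G = (\<lambda>n u. LBINT \<tau>. of_real (exp (- e n * \<tau>\<^sup>2)) * nfraf \<theta> k x \<tau> u)"
  have [measurable]: "G n \<in> borel_measurable borel" for n
    unfolding G_def nfraf_eq_amb by measurable
  have lim': "(\<lambda>n. \<integral>\<^sup>+ u. ennreal (cmod (G n u - R u)) \<partial>lborel) \<longlonglongrightarrow> 0"
    using filterlim_compose[OF lim e] by (simp add: G_def)
  have "(\<integral>\<^sup>+ u. liminf (\<lambda>n. ennreal (cmod (G n u - R u))) \<partial>lborel)
      \<le> liminf (\<lambda>n. \<integral>\<^sup>+ u. ennreal (cmod (G n u - R u)) \<partial>lborel)"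
    by (rule nn_integral_liminf) measurable
  also have "\<dots> = 0" using lim' by (intro lim_imp_Liminf) simp_all
  finally have "(\<integral>\<^sup>+ u. liminf (\<lambda>n. ennreal (cmod (G n u - R u))) \<partial>lborel) = 0" by simp
  then have "AE u in lborel. liminf (\<lambda>n. ennreal (cmod (G n u - R u))) = 0"
    by (subst (asm) nn_integral_0_iff_AE) measurable
  then show ?thesis
  proof eventually_elim
    case (elim u)
    show ?case
    proof
      assume i: "integrable lborel (\<lambda>\<tau>. nfraf \<theta> k x \<tau> u)"
      have m: "(\<lambda>\<tau>. nfraf \<theta> k x \<tau> u) \<in> borel_measurable borel" using i by auto
      have "(\<lambda>n. G n u) \<longlonglongrightarrow> (LBINT \<tau>. nfraf \<theta> k x \<tau> u)"
        unfolding G_def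
      proof (rule integral_dominated_convergence[OF _ _ integrable_norm[OF i]])
        show "(\<lambda>\<tau>. nfraf \<theta> k x \<tau> u) \<in> borel_measurable lborel" using m by simp
        show "(\<lambda>\<tau>. of_real (exp (- e n * \<tau>\<^sup>2)) * nfraf \<theta> k x \<tau> u) \<in> borel_measurable lborel" for n
          using m by measurable
        show "AE \<tau> in lborel. (\<lambda>n. of_real (exp (- e n * \<tau>\<^sup>2)) * nfraf \<theta> k x \<tau> u) \<longlonglongrightarrow> nfraf \<theta> k x \<tau> u"
        proof (rule AE_I2)
          fix \<tau>
          have "(\<lambda>n. of_real (exp (- e n * \<tau>\<^sup>2)) * nfraf \<theta> k x \<tau> u)
             \<longlonglongrightarrow> of_real (exp (- 0 * \<tau>\<^sup>2)) * nfraf \<theta> k x \<tau> u"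
            by (intro tendsto_intros e0)
          then show "(\<lambda>n. of_real (exp (- e n * \<tau>\<^sup>2)) * nfraf \<theta> k x \<tau> u) \<longlonglongrightarrow> nfraf \<theta> k x \<tau> u" by simp
        qed
        show "AE \<tau> in lborel. norm (of_real (exp (- e n * \<tau>\<^sup>2)) * nfraf \<theta> k x \<tau> u) \<le> norm (nfraf \<theta> k x \<tau> u)" for n
          by (intro AE_I2) (simp add: norm_mult mult_left_le_one_le e_def)
      qed
      then have "(\<lambda>n. ennreal (cmod (G n u - R u))) \<longlonglongrightarrow> ennreal (cmod ((LBINT \<tau>. nfraf \<theta> k x \<tau> u) - R u))"
        by (intro tendsto_intros)
      then have "liminf (\<lambda>n. ennreal (cmod (G n u - R u))) = ennreal (cmod ((LBINT \<tau>. nfraf \<theta> k x \<tau> u) - R u))"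
        by (intro lim_imp_Liminf) simp_all
      then show "(LBINT \<tau>. nfraf \<theta> k x \<tau> u) = R u" using elim by simp
    qed
  qed
qed

lemma nfraf_marginal_integrable:
  assumes x: "integrable lborel x" and k: "k > 0"
  shows "integrable lborel (\<lambda>\<tau>. nfraf \<theta> k x \<tau> u)"
    and "(LBINT \<tau>. nfraf \<theta> k x \<tau> u) = 1 / of_real k * frft \<theta> x (u / 2) * cnj (frft \<theta> x (- u / 2))"
proof -
  have F: "frft \<theta> x = frft_int \<theta> x" using x by (simp add: frft_def frft_int_def fun_eq_iff)
  have a: "k / 2 > 0" using k by simp
  note m = amb_marginal[OF integrable_chirp[OF x] a, of \<theta> "u * csc \<theta>"]
  show "integrable lborel (\<lambda>\<tau>. nfraf \<theta> k x \<tau> u)"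
    unfolding nfraf_eq_amb by (intro integrable_mult_right m)
  have "(LBINT \<tau>. nfraf \<theta> k x \<tau> u) = of_real ((cmod (Omega \<theta>))\<^sup>2) * (of_real (1 / (2 * (k / 2))) *
      (ft (chirp \<theta> x) (u * csc \<theta> / 2) * cnj (ft (chirp \<theta> x) (- (u * csc \<theta> / 2)))))"
    unfolding nfraf_eq_amb by (simp only: integral_mult_right_zero m(2))
  also have "\<dots> = 1 / of_real k * (frft_int \<theta> x (u / 2) * cnj (frft_int \<theta> x (- u / 2)))"
    unfolding frft_int_product by simp
  finally show "(LBINT \<tau>. nfraf \<theta> k x \<tau> u) = 1 / of_real k * frft \<theta> x (u / 2) * cnj (frft \<theta> x (- u / 2))"
    unfolding F by (simp only: mult.assoc)
qed

theorem mainTheorem4: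
  fixes x :: "real \<Rightarrow> complex" and k \<theta> :: real
  assumes "square_integrable x"
    and "k \<in> \<rat>" and "k > 0"
    and "\<And>n::int. \<theta> \<noteq> of_int n * pi"
  shows "(AE u in lborel. integrable lborel (\<lambda>\<tau>. nfraf \<theta> k x \<tau> u) \<longrightarrow>
            (LBINT \<tau>. nfraf \<theta> k x \<tau> u) =
              1 / of_real k * frft \<theta> x (u / 2) * cnj (frft \<theta> x (- u / 2)))
       \<and> ((\<lambda>\<epsilon>. \<integral>\<^sup>+ u. ennreal (cmod
              ((LBINT \<tau>. of_real (exp (- \<epsilon> * \<tau>\<^sup>2)) * nfraf \<theta> k x \<tau> u)
               - 1 / of_real k * frft \<theta> x (u / 2) * cnj (frft \<theta> x (- u / 2)))) \<partial>lborel)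
            \<longlongrightarrow> 0) (at_right 0)
       \<and> (integrable lborel x \<longrightarrow>
            (\<forall>u. integrable lborel (\<lambda>\<tau>. nfraf \<theta> k x \<tau> u) \<and>
              (LBINT \<tau>. nfraf \<theta> k x \<tau> u) =
                1 / of_real k * frft \<theta> x (u / 2) * cnj (frft \<theta> x (- u / 2))))"
proof -
  have "sin \<theta> \<noteq> 0"
    using assms(4) by (auto simp: sin_zero_iff_int2)
  then have c: "csc \<theta> \<noteq> 0" by (simp add: csc_def)
  have F: "is_frft_mean_limit \<theta> x (frft \<theta> x)" by (rule frft_is_mean_limit[OF assms(1) c])
  have [measurable]: "frft \<theta> x \<in> borel_measurable borel" using F by (simp add: is_frft_mean_limit_iff)
  note lim = damped_marginal_tendsto_L1[OF assms(1,3) c F]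
  have "AE u in lborel. integrable lborel (\<lambda>\<tau>. nfraf \<theta> k x \<tau> u) \<longrightarrow>
            (LBINT \<tau>. nfraf \<theta> k x \<tau> u) = 1 / of_real k * frft \<theta> x (u / 2) * cnj (frft \<theta> x (- u / 2))"
    by (rule marginal_AE_of_damped[OF assms(1) _ lim]) measurable
  then show ?thesis
    using lim nfraf_marginal_integrable[OF _ assms(3)] by blast
qed

end
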